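(* Let $f$ be a slice-regular function defined on a (spherically symmetric) neighbourhood of the closure of $U$, and suppose that $f$ does not vanish on the boundary $bU$. If $f$ has $k$ isolated (real or non-real) zeros and $m$ spherical zeros in $U$, counted with multiplicities, then $$\frac{1}{2\pi\iota}\int_{b\mathcal{U}}\frac{(\Phi\circ F)'(z)}{(\Phi\circ F)(z)}\,dz=2k+4m,$$ where $z=x+\iota y$.
   Context: $\mathbb{H}$ is the algebra of quaternions with standard basis $1,i,j,k$, $\mathbb{S}=\{q\in\mathbb{H}: q^2=-1\}$, and $\iota$ is the imaginary unit of $\mathbb{C}$. $\mathcal{U}\subset\mathbb{C}\cong\mathbb{R}^2$ is an open domain (connected) invariant under complex conjugation, and $U=\{x+vy: x+\iota y\in\mathcal{U},\ v\in\mathbb{S}\}$; sets of this form are called spherically symmetric. Here $\mathcal{U}$ is bounded with piecewise $C^1$ boundary, and $b\mathcal{U}$ is positively oriented. A (left) slice-regular function on a spherically symmetric set $U$ (associated with $\mathcal{U}$) is $f:U\to\mathbb{H}$ with $f(x+vy)=\alpha(x,y)+v\beta(x,y)$ for all $x+\iota y\in\mathcal{U}$, $v\in\mathbb{S}$, where $\alpha,\beta:\mathcal{U}\to\mathbb{H}$ are differentiable with $\alpha(x,-y)=\alpha(x,y)$, $\beta(x,-y)=-\beta(x,y)$, $\partial_x\alpha=\partial_y\beta$, $\partial_y\alpha=-\partial_x\beta$. Writing $\alpha=\alpha_0+\alpha_1i+\alpha_2j+\alpha_3k$ and $\beta=\beta_0+\beta_1i+\beta_2j+\beta_3k$ with real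 components, the associated holomorphic map is $F=(f_0,f_1,f_2,f_3):\mathcal{U}\to\mathbb{C}^4$, $f_m(x+\iota y)=\alpha_m(x,y)+\iota\beta_m(x,y)$. Put $\Phi(z)=z_0^2+z_1^2+z_2^2+z_3^2$ on $\mathbb{C}^4$. The $\star$-product of slice-regular functions $f=\alpha+v\beta$ and $g=\gamma+v\delta$ is the slice-regular function $(f\star g)(x+vy)=(\alpha\gamma-\beta\delta)(x,y)+v(\alpha\delta+\beta\gamma)(x,y)$. Zeros and multiplicities ($f\not\equiv0$). A real zero $x$ (also called isolated) has multiplicity $n$ if $f(q)=(q-x)^n g(q)$ with $g$ slice-regular near $x$, $g(x)\ne 0$. For a non-real sphere $S=[x+vy]=\{x+wy: w\in\mathbb{S}\}$, $y\neq0$, one can write near $S$ $$f(q)=\big((q-x)^2+y^2\big)^{m}\,\tilde f(q),\qquad \tilde f=(q-p_1)\star\cdots\star(q-p_n)\star g,$$ with $m,n\ge 0$, $\tilde f$ slice-regular and not identically zero on $S$, $p_1,\dots,p_n\in S$, and $g$ slice-regular with no zero on $S$. If $m\geq1$, $S$ is a spherical zero of multiplicity $m$; if $n\ge1$, $S$ carries an isolated non-real zero (at $p_1$) of multiplicity $n$. If both occur, both are counted. *)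

theory Defs
  imports "HOL-Complex_Analysis.Complex_Analysis"
begin

section \<open>Quaternions as a real normed division algebra\<close>

datatype quat = Quat (qre: real) (qi: real) (qj: real) (qk: real)

lemma quat_eq_iff: "p = q \<longleftrightarrow> qre p = qre q \<and> qi p = qi q \<and> qj p = qj q \<and> qk p = qk q"
  by (cases p; cases q) simp

instantiation quat :: ab_group_add
begin

definition zero_quat :: quat where "0 = Quat 0 0 0 0"

definition plus_quat :: "quat \<Rightarrow> quat \<Rightarrow> quat" where
  "p + q = Quat (qre p + qre q) (qi p + qi q) (qj p + qj q) (qk p + qk q)"

definition uminus_quat :: "quat \<Rightarrow> quat" where
  "- p = Quat (- qre p) (- qi p) (- qj p) (- qk p)"

definition minus_quat :: "quat \<Rightarrow> quat \<Rightarrow> quat" where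
  "p - q = Quat (qre p - qre q) (qi p - qi q) (qj p - qj q) (qk p - qk q)"

instance
  by standard (simp_all add: quat_eq_iff zero_quat_def plus_quat_def uminus_quat_def minus_quat_def)

end

instantiation quat :: ring_1
begin

definition one_quat :: quat where "1 = Quat 1 0 0 0"

definition times_quat :: "quat \<Rightarrow> quat \<Rightarrow> quat" where
  "p * q = Quat
     (qre p * qre q - qi p * qi q - qj p * qj q - qk p * qk q)
     (qre p * qi q + qi p * qre q + qj p * qk q - qk p * qj q)
     (qre p * qj q - qi p * qk q + qj p * qre q + qk p * qi q)
     (qre p * qk q + qi p * qj q - qj p * qi q + qk p * qre q)"

instance
  by standard
    (simp_all add: quat_eq_iff zero_quat_def plus_quat_def one_quat_def times_quat_def algebra_simps)

end

instantiation quat :: real_algebra_1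
begin

definition scaleR_quat :: "real \<Rightarrow> quat \<Rightarrow> quat" where
  "r *\<^sub>R q = Quat (r * qre q) (r * qi q) (r * qj q) (r * qk q)"

instance
  by standard (simp_all add: quat_eq_iff scaleR_quat_def plus_quat_def times_quat_def algebra_simps)

end

lemma quat_sel_simps [simp]:
  "qre 0 = 0" "qi 0 = 0" "qj 0 = 0" "qk 0 = 0"
  "qre 1 = 1" "qi 1 = 0" "qj 1 = 0" "qk 1 = 0"
  "qre (p + q) = qre p + qre q" "qi (p + q) = qi p + qi q"
  "qj (p + q) = qj p + qj q" "qk (p + q) = qk p + qk q"
  "qre (- p) = - qre p" "qi (- p) = - qi p" "qj (- p) = - qj p" "qk (- p) = - qk p"
  "qre (p - q) = qre p - qre q" "qi (p - q) = qi p - qi q"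
  "qj (p - q) = qj p - qj q" "qk (p - q) = qk p - qk q"
  "qre (r *\<^sub>R p) = r * qre p" "qi (r *\<^sub>R p) = r * qi p"
  "qj (r *\<^sub>R p) = r * qj p" "qk (r *\<^sub>R p) = r * qk p"
  by (simp_all add: zero_quat_def one_quat_def plus_quat_def uminus_quat_def minus_quat_def
      scaleR_quat_def)

lemma quat_times_sel:
  "qre (p * q) = qre p * qre q - qi p * qi q - qj p * qj q - qk p * qk q"
  "qi (p * q) = qre p * qi q + qi p * qre q + qj p * qk q - qk p * qj q"
  "qj (p * q) = qre p * qj q - qi p * qk q + qj p * qre q + qk p * qi q"
  "qk (p * q) = qre p * qk q + qi p * qj q - qj p * qi q + qk p * qre q"
  by (simp_all add: times_quat_def)

instantiation quat :: real_inner
begin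

definition inner_quat :: "quat \<Rightarrow> quat \<Rightarrow> real" where
  "inner p q = qre p * qre q + qi p * qi q + qj p * qj q + qk p * qk q"

definition norm_quat :: "quat \<Rightarrow> real" where "norm_quat q = sqrt (inner q q)"

definition sgn_quat :: "quat \<Rightarrow> quat" where "sgn_quat q = q /\<^sub>R norm q"

definition dist_quat :: "quat \<Rightarrow> quat \<Rightarrow> real" where "dist_quat p q = norm (p - q)"

definition uniformity_quat :: "(quat \<times> quat) filter" where
  "uniformity_quat = (INF e\<in>{0 <..}. principal {(x, y). dist x y < e})"

definition open_quat :: "quat set \<Rightarrow> bool" where
  "open_quat U \<longleftrightarrow> (\<forall>x\<in>U. eventually (\<lambda>(x', y). x' = x \<longrightarrow> y \<in> U) uniformity)"

instance
proof
  fix p q r :: quat and a :: real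
  show "inner p q = inner q p" "inner (p + q) r = inner p r + inner q r"
    "inner (a *\<^sub>R p) q = a * inner p q"
    by (simp_all add: inner_quat_def algebra_simps)
  show "0 \<le> inner p p" by (simp add: inner_quat_def)
  show "(inner p p = 0) = (p = 0)"
    by (auto simp: inner_quat_def quat_eq_iff add_nonneg_eq_0_iff)
qed (simp_all add: norm_quat_def sgn_quat_def dist_quat_def uniformity_quat_def open_quat_def)

end

lemma norm_quat_mult: "norm (p * q) = norm p * norm (q :: quat)"
proof -
  have "inner (p * q) (p * q) = inner p p * inner q q"
    by (simp add: inner_quat_def quat_times_sel) algebra
  then show ?thesis by (simp add: norm_quat_def real_sqrt_mult)
qed

instantiation quat :: real_normed_div_algebra
begin

definition inverse_quat :: "quat \<Rightarrow> quat" where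
  "inverse q = Quat (qre q) (- qi q) (- qj q) (- qk q) /\<^sub>R inner q q"

definition divide_quat :: "quat \<Rightarrow> quat \<Rightarrow> quat" where "divide_quat p q = p * inverse q"

instance
proof
  fix p q :: quat
  show "inverse (0 :: quat) = 0"
    by (simp add: inverse_quat_def quat_eq_iff)
  show "norm (p * q) = norm p * norm q" by (rule norm_quat_mult)
  show "p div q = p * inverse q" by (rule divide_quat_def)
  assume "p \<noteq> 0"
  then have n: "inner p p \<noteq> 0" by simp
  let ?c = "Quat (qre p) (- qi p) (- qj p) (- qk p)"
  have c: "?c * p = inner p p *\<^sub>R 1" "p * ?c = inner p p *\<^sub>R 1"
    by (simp_all add: quat_eq_iff quat_times_sel inner_quat_def)
  show "inverse p * p = 1" "p * inverse p = 1"
    unfolding inverse_quat_def mult_scaleR_left mult_scaleR_right c using n by simp_all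
qed

end


section \<open>Slice-regular functions\<close>

definition imag_units :: "quat set" where
  "imag_units = {q. q\<^sup>2 = -1}"

text \<open>A point of \<open>\<complex>\<close> stands for its pair of real coordinates \<open>(x, y)\<close>; \<open>slice_pt v\<close> sends it to
  \<open>x + v y\<close>.\<close>

definition slice_pt :: "quat \<Rightarrow> complex \<Rightarrow> quat" where
  "slice_pt v z = of_real (Re z) + v * of_real (Im z)"

definition qsphere :: "complex \<Rightarrow> quat set" where
  "qsphere z = {slice_pt v z | v. v \<in> imag_units}"

definition circularize :: "complex set \<Rightarrow> quat set" where
  "circularize V = {slice_pt v z | v z. v \<in> imag_units \<and> z \<in> V}"

text \<open>No connectedness here: the planar trace of a small neighbourhood of a non-real sphere is
  a pair of discs.\<close>

definition symmetric_open :: "complex set \<Rightarrow> bool" where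
  "symmetric_open V \<longleftrightarrow> open V \<and> cnj ` V = V"

definition partial_x :: "(complex \<Rightarrow> quat) \<Rightarrow> complex \<Rightarrow> quat" where
  "partial_x g z = vector_derivative (\<lambda>t. g (Complex t (Im z))) (at (Re z))"

definition partial_y :: "(complex \<Rightarrow> quat) \<Rightarrow> complex \<Rightarrow> quat" where
  "partial_y g z = vector_derivative (\<lambda>t. g (Complex (Re z) t)) (at (Im z))"

definition slice_stem ::
    "complex set \<Rightarrow> (quat \<Rightarrow> quat) \<Rightarrow> (complex \<Rightarrow> quat) \<Rightarrow> (complex \<Rightarrow> quat) \<Rightarrow> bool" where
  "slice_stem V f \<alpha> \<beta> \<longleftrightarrow>
     (\<forall>z\<in>V. \<forall>v\<in>imag_units. f (slice_pt v z) = \<alpha> z + v * \<beta> z) \<and>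
     \<alpha> differentiable_on V \<and> \<beta> differentiable_on V \<and>
     (\<forall>z\<in>V. \<alpha> (cnj z) = \<alpha> z \<and> \<beta> (cnj z) = - \<beta> z) \<and>
     (\<forall>z\<in>V. partial_x \<alpha> z = partial_y \<beta> z \<and> partial_y \<alpha> z = - partial_x \<beta> z)"

definition slice_regular :: "complex set \<Rightarrow> (quat \<Rightarrow> quat) \<Rightarrow> bool" where
  "slice_regular V f \<longleftrightarrow> (\<exists>\<alpha> \<beta>. slice_stem V f \<alpha> \<beta>)"

text \<open>The value does not depend on the choices of stems, \<open>z\<close> and \<open>v\<close>:
  see \<open>star_slice_pt\<close> below.\<close>

definition star :: "complex set \<Rightarrow> (quat \<Rightarrow> quat) \<Rightarrow> (quat \<Rightarrow> quat) \<Rightarrow> quat \<Rightarrow> quat" where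
  "star V f g q = (THE r. \<exists>\<alpha> \<beta> \<gamma> \<delta> z v.
     slice_stem V f \<alpha> \<beta> \<and> slice_stem V g \<gamma> \<delta> \<and> z \<in> V \<and> v \<in> imag_units \<and> q = slice_pt v z \<and>
     r = (\<alpha> z * \<gamma> z - \<beta> z * \<delta> z) + v * (\<alpha> z * \<delta> z + \<beta> z * \<gamma> z))"

lemma imag_unitsD:
  assumes "v \<in> imag_units"
  shows "qre v = 0" "(qi v)\<^sup>2 + (qj v)\<^sup>2 + (qk v)\<^sup>2 = 1"
proof -
  have *: "qre v * qre v - qi v * qi v - qj v * qj v - qk v * qk v = -1"
    "qre v * qi v = 0" "qre v * qj v = 0" "qre v * qk v = 0"
    using assms by (auto simp: imag_units_def power2_eq_square quat_eq_iff quat_times_sel)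
  show re: "qre v = 0"
  proof (rule ccontr)
    assume "qre v \<noteq> 0"
    with * have "qre v * qre v = -1" by auto
    moreover have "qre v * qre v \<ge> 0" by simp
    ultimately show False by linarith
  qed
  with * show "(qi v)\<^sup>2 + (qj v)\<^sup>2 + (qk v)\<^sup>2 = 1" by (simp add: power2_eq_square)
qed

lemma imag_units_minus: "v \<in> imag_units \<Longrightarrow> - v \<in> imag_units"
  by (simp add: imag_units_def)

lemma imag_units_nonempty: "Quat 0 1 0 0 \<in> imag_units"
  by (simp add: imag_units_def power2_eq_square quat_eq_iff quat_times_sel)

lemma of_real_quat: "(of_real x :: quat) = Quat x 0 0 0"
  by (simp add: of_real_def quat_eq_iff)

lemma slice_pt_sel:
  assumes "v \<in> imag_units"
  shows "qre (slice_pt v z) = Re z" "qi (slice_pt v z) = qi v * Im z"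
    "qj (slice_pt v z) = qj v * Im z" "qk (slice_pt v z) = qk v * Im z"
  using imag_unitsD(1)[OF assms] by (simp_all add: slice_pt_def of_real_quat quat_times_sel)

lemma slice_pt_eq_iff:
  assumes "v \<in> imag_units" "w \<in> imag_units"
  shows "slice_pt v z = slice_pt w z' \<longleftrightarrow>
    (z = z' \<and> (v = w \<or> Im z = 0)) \<or> (z = cnj z' \<and> (v = - w \<or> Im z = 0))"
    (is "?l \<longleftrightarrow> ?r")
proof
  assume ?l
  then have e: "Re z = Re z'" "qi v * Im z = qi w * Im z'" "qj v * Im z = qj w * Im z'"
    "qk v * Im z = qk w * Im z'"
    using slice_pt_sel[OF assms(1), of z] slice_pt_sel[OF assms(2), of z'] by auto
  have "(Im z)\<^sup>2 * ((qi v)\<^sup>2 + (qj v)\<^sup>2 + (qk v)\<^sup>2) = (Im z')\<^sup>2 * ((qi w)\<^sup>2 + (qj w)\<^sup>2 + (qk w)\<^sup>2)"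
    using e(2-4) by algebra
  then have "(Im z)\<^sup>2 = (Im z')\<^sup>2"
    using imag_unitsD(2)[OF assms(1)] imag_unitsD(2)[OF assms(2)] by simp
  then consider "Im z = Im z'" | "Im z = - Im z'"
    by (auto simp: power2_eq_iff)
  then show ?r
  proof cases
    case 1
    have "v = w \<or> Im z = 0"
      using e 1 imag_unitsD(1)[OF assms(1)] imag_unitsD(1)[OF assms(2)]
      by (auto simp: quat_eq_iff)
    then show ?thesis using 1 e(1) by (auto simp: complex_eq_iff)
  next
    case 2
    have "v = - w \<or> Im z = 0"
    proof (rule disjCI)
      assume "Im z \<noteq> 0"
      moreover have "qi v * Im z = (- qi w) * Im z" "qj v * Im z = (- qj w) * Im z"
        "qk v * Im z = (- qk w) * Im z"
        using e 2 by auto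
      ultimately have "qi v = - qi w" "qj v = - qj w" "qk v = - qk w"
        unfolding mult_cancel_right by blast+
      then show "v = - w"
        using imag_unitsD(1)[OF assms(1)] imag_unitsD(1)[OF assms(2)]
        by (simp add: quat_eq_iff)
    qed
    then show ?thesis using 2 e(1) by (auto simp: complex_eq_iff)
  qed
qed (auto simp: slice_pt_def)

lemma slice_stem_real:
  assumes "slice_stem V f \<alpha> \<beta>" "z \<in> V" "Im z = 0"
  shows "\<beta> z = 0"
proof -
  have "cnj z = z" using assms(3) by (simp add: complex_eq_iff)
  then have "\<beta> z = - \<beta> z" using assms(1,2) by (metis slice_stem_def)
  then show ?thesis by (simp add: quat_eq_iff)
qed

lemma slice_stem_unique:
  assumes "slice_stem V f \<alpha> \<beta>" "slice_stem V f \<alpha>' \<beta>'" "z \<in> V"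
  shows "\<alpha> z = \<alpha>' z" "\<beta> z = \<beta>' z"
proof -
  let ?v = "Quat 0 1 0 0"
  have "\<alpha> z + ?v * \<beta> z = \<alpha>' z + ?v * \<beta>' z" "\<alpha> z + (- ?v) * \<beta> z = \<alpha>' z + (- ?v) * \<beta>' z"
    using assms imag_units_nonempty imag_units_minus[OF imag_units_nonempty]
    by (metis slice_stem_def)+
  then show "\<alpha> z = \<alpha>' z" "\<beta> z = \<beta>' z"
    by (auto simp: quat_eq_iff quat_times_sel)
qed

lemma star_slice_pt:
  assumes f: "slice_stem V f \<alpha> \<beta>" and g: "slice_stem V g \<gamma> \<delta>"
    and z: "z \<in> V" and v: "v \<in> imag_units"
  shows "star V f g (slice_pt v z) =
    (\<alpha> z * \<gamma> z - \<beta> z * \<delta> z) + v * (\<alpha> z * \<delta> z + \<beta> z * \<gamma> z)"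
  unfolding star_def
proof (rule the_equality)
  show "\<exists>\<alpha>' \<beta>' \<gamma>' \<delta>' z' v'. slice_stem V f \<alpha>' \<beta>' \<and> slice_stem V g \<gamma>' \<delta>' \<and> z' \<in> V \<and>
      v' \<in> imag_units \<and> slice_pt v z = slice_pt v' z' \<and>
      (\<alpha> z * \<gamma> z - \<beta> z * \<delta> z) + v * (\<alpha> z * \<delta> z + \<beta> z * \<gamma> z) =
      (\<alpha>' z' * \<gamma>' z' - \<beta>' z' * \<delta>' z') + v' * (\<alpha>' z' * \<delta>' z' + \<beta>' z' * \<gamma>' z')"
    using assms by blast
next
  fix r
  assume "\<exists>\<alpha>' \<beta>' \<gamma>' \<delta>' z' v'. slice_stem V f \<alpha>' \<beta>' \<and> slice_stem V g \<gamma>' \<delta>' \<and> z' \<in> V \<and>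
      v' \<in> imag_units \<and> slice_pt v z = slice_pt v' z' \<and>
      r = (\<alpha>' z' * \<gamma>' z' - \<beta>' z' * \<delta>' z') + v' * (\<alpha>' z' * \<delta>' z' + \<beta>' z' * \<gamma>' z')"
  then obtain \<alpha>' \<beta>' \<gamma>' \<delta>' z' v' where f': "slice_stem V f \<alpha>' \<beta>'" and g': "slice_stem V g \<gamma>' \<delta>'"
    and z': "z' \<in> V" and v': "v' \<in> imag_units" and eq: "slice_pt v z = slice_pt v' z'"
    and r: "r = (\<alpha>' z' * \<gamma>' z' - \<beta>' z' * \<delta>' z') + v' * (\<alpha>' z' * \<delta>' z' + \<beta>' z' * \<gamma>' z')"
    by blast
  have r': "r = (\<alpha> z' * \<gamma> z' - \<beta> z' * \<delta> z') + v' * (\<alpha> z' * \<delta> z' + \<beta> z' * \<gamma> z')"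
    using slice_stem_unique[OF f f' z'] slice_stem_unique[OF g g' z'] r by simp
  have cn: "\<alpha> (cnj z') = \<alpha> z'" "\<beta> (cnj z') = - \<beta> z'" "\<gamma> (cnj z') = \<gamma> z'" "\<delta> (cnj z') = - \<delta> z'"
    using f g z' by (auto simp: slice_stem_def)
  have re: "Im z = 0 \<Longrightarrow> \<beta> z = 0" "Im z = 0 \<Longrightarrow> \<delta> z = 0"
    using slice_stem_real[OF f z] slice_stem_real[OF g z] by auto
  from eq[unfolded slice_pt_eq_iff[OF v v']]
  show "r = (\<alpha> z * \<gamma> z - \<beta> z * \<delta> z) + v * (\<alpha> z * \<delta> z + \<beta> z * \<gamma> z)"
    using r' re cn by (auto simp: algebra_simps)
qed


section \<open>Multiplicities and zero counts\<close>

definition real_zero_mult :: "(quat \<Rightarrow> quat) \<Rightarrow> real \<Rightarrow> nat" where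
  "real_zero_mult f x = (THE n. \<exists>V g. symmetric_open V \<and> of_real x \<in> V \<and> slice_regular V g \<and>
     g (of_real x) \<noteq> 0 \<and> (\<forall>q\<in>circularize V. f q = (q - of_real x) ^ n * g q))"

definition sphere_factorization :: "(quat \<Rightarrow> quat) \<Rightarrow> complex \<Rightarrow> nat \<Rightarrow> nat \<Rightarrow> bool" where
  "sphere_factorization f z m n \<longleftrightarrow> (\<exists>V h g ps. symmetric_open V \<and> z \<in> V \<and>
     slice_regular V h \<and> slice_regular V g \<and>
     (\<exists>q\<in>qsphere z. h q \<noteq> 0) \<and> (\<forall>q\<in>qsphere z. g q \<noteq> 0) \<and>
     set ps \<subseteq> qsphere z \<and> length ps = n \<and>
     (\<forall>q\<in>circularize V.
        f q = ((q - of_real (Re z))\<^sup>2 + of_real ((Im z)\<^sup>2)) ^ m * h q \<and>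
        h q = foldr (\<lambda>p u. star V (\<lambda>q'. q' - p) u) ps g q))"

definition spherical_mult :: "(quat \<Rightarrow> quat) \<Rightarrow> complex \<Rightarrow> nat" where
  "spherical_mult f z = (THE m. \<exists>n. sphere_factorization f z m n)"

definition isolated_mult :: "(quat \<Rightarrow> quat) \<Rightarrow> complex \<Rightarrow> nat" where
  "isolated_mult f z = (THE n. \<exists>m. sphere_factorization f z m n)"

text \<open>Each non-real sphere in \<open>circularize D\<close> is \<open>qsphere z\<close> for exactly one \<open>z \<in> D\<close> with
  \<open>Im z > 0\<close>, provided \<open>D\<close> is invariant under conjugation. The sums below range over finite
  sets whenever \<open>f\<close> is slice-regular near the closure of a bounded domain and has no zero on its
  boundary; otherwise \<open>sum\<close> may take its default value 0.\<close>

definition zero_spheres :: "complex set \<Rightarrow> (quat \<Rightarrow> quat) \<Rightarrow> complex set" where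
  "zero_spheres D f = {z \<in> D. Im z > 0 \<and> (\<exists>q\<in>qsphere z. f q = 0)}"

definition isolated_zero_count :: "complex set \<Rightarrow> (quat \<Rightarrow> quat) \<Rightarrow> nat" where
  "isolated_zero_count D f =
     (\<Sum>x | of_real x \<in> D \<and> f (of_real x) = 0. real_zero_mult f x) +
     (\<Sum>z\<in>zero_spheres D f. isolated_mult f z)"

definition spherical_zero_count :: "complex set \<Rightarrow> (quat \<Rightarrow> quat) \<Rightarrow> nat" where
  "spherical_zero_count D f = (\<Sum>z\<in>zero_spheres D f. spherical_mult f z)"


section \<open>The associated holomorphic map\<close>

definition hol_map ::
    "(complex \<Rightarrow> quat) \<Rightarrow> (complex \<Rightarrow> quat) \<Rightarrow> complex \<Rightarrow> complex \<times> complex \<times> complex \<times> complex" where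
  "hol_map \<alpha> \<beta> z =
     (Complex (qre (\<alpha> z)) (qre (\<beta> z)), Complex (qi (\<alpha> z)) (qi (\<beta> z)),
      Complex (qj (\<alpha> z)) (qj (\<beta> z)), Complex (qk (\<alpha> z)) (qk (\<beta> z)))"

definition Phi :: "complex \<times> complex \<times> complex \<times> complex \<Rightarrow> complex" where
  "Phi = (\<lambda>(z0, z1, z2, z3). z0\<^sup>2 + z1\<^sup>2 + z2\<^sup>2 + z3\<^sup>2)"


section \<open>Positively oriented piecewise smooth boundary\<close>

text \<open>The boundary of \<open>D\<close> is a finite disjoint union of piecewise \<open>C\<^sup>1\<close> Jordan curves; those having
  \<open>D\<close> in their interior run counterclockwise, the others (around the holes of \<open>D\<close>) clockwise.\<close>

definition positively_oriented_boundary :: "complex set \<Rightarrow> (real \<Rightarrow> complex) set \<Rightarrow> bool" where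
  "positively_oriented_boundary D \<Gamma> \<longleftrightarrow>
     finite \<Gamma> \<and>
     (\<forall>\<gamma>\<in>\<Gamma>. valid_path \<gamma> \<and> simple_path \<gamma> \<and> pathfinish \<gamma> = pathstart \<gamma>) \<and>
     (\<forall>\<gamma>\<in>\<Gamma>. \<forall>\<eta>\<in>\<Gamma>. \<gamma> \<noteq> \<eta> \<longrightarrow> path_image \<gamma> \<inter> path_image \<eta> = {}) \<and>
     (\<Union>\<gamma>\<in>\<Gamma>. path_image \<gamma>) = frontier D \<and>
     (\<forall>\<gamma>\<in>\<Gamma>. \<forall>w \<in> inside (path_image \<gamma>).
        winding_number \<gamma> w = (if D \<subseteq> inside (path_image \<gamma>) then 1 else -1))"

end

theory Submission
  imports Defs
begin

text \<open>
  A slice-regular function \<open>f\<close> with stem components \<open>\<alpha>\<close> and \<open>\<beta>\<close> is encoded in the single function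
  \<open>F = \<alpha> + \<iota> \<beta>\<close> with values in the complexified quaternions. The Cauchy-Riemann equations say that \<open>F\<close>
  is holomorphic, and the \<open>\<star>\<close>-product of slice functions is the pointwise product of their stems. The
  squared norm of the quaternions extends to a complex quadratic form, here \<open>bform\<close>, which is
  again multiplicative, and \<open>\<Phi> \<circ> F = bform \<circ> F\<close>. Moreover \<open>bform (F z) = 0\<close> if and only if \<open>f\<close>
  has a zero on the sphere of \<open>z\<close> (\<open>bform_eq_0_iff\<close>). By the argument principle the integral therefore
  counts the zeros of the scalar holomorphic function \<open>bform \<circ> F\<close> in \<open>D\<close>, and it remains to find their
  orders.

  At a real zero of multiplicity \<open>n\<close> one has \<open>F w = (w - x)\<^sup>n G w\<close> with a scalar first factor, so the order
  is \<open>2 n\<close> (\<open>zorder_bform_real\<close>). Near a non-real sphere \<open>F\<close> is a product of \<open>m\<close> scalar factors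
  \<open>N w = (w - z) (w - cnj z)\<close>, of \<open>n\<close> linear factors \<open>w - p\<close> with \<open>p\<close> on the sphere, and of a stem
  with non-zero form. The form of \<open>N w\<close> is its square and the form of \<open>w - p\<close> is \<open>N w\<close>, so the order is
  \<open>2 m + n\<close> at \<open>z\<close> and also at the conjugate point (\<open>zorder_bform_nonreal\<close>). Adding up gives
  \<open>2 k + 4 m\<close> (\<open>sum_zorder_bform\<close>).

  Multiplicities are defined by definite description, so factorizations must be shown to
  exist and to determine their exponents. Existence is by repeated division, which stops because each
  division lowers the order of \<open>bform \<circ> F\<close>. Uniqueness follows by comparing stems and orders.

  The argument principle is needed for a boundary made of several Jordan curves. It rests on two facts:
  the winding numbers of the curves add up to 1 in \<open>D\<close> and to 0 off its closure
  (\<open>winding_number_oriented_boundary\<close>, by the Jordan curve theorem and Janiszewski's theorem), and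
  the curves can be joined to one loop without changing integrals (\<open>cycle_as_single_loop\<close>).
\<close>

section \<open>The oriented boundary as a cycle\<close>

lemma Jordan_curve_sides:
  fixes c :: "real \<Rightarrow> complex"
  assumes "simple_path c" "pathfinish c = pathstart c"
  shows "connected (inside (path_image c))" "connected (outside (path_image c))"
    "closure (inside (path_image c)) = inside (path_image c) \<union> path_image c"
    "closure (outside (path_image c)) = outside (path_image c) \<union> path_image c"
    "\<not> bounded (outside (path_image c))" "bounded (inside (path_image c))"
proof -
  note J = Jordan_inside_outside[OF assms]
  have fr: "frontier (inside (path_image c)) = path_image c"
    "frontier (outside (path_image c)) = path_image c"
    using J by blast+
  show "closure (inside (path_image c)) = inside (path_image c) \<union> path_image c"
    "closure (outside (path_image c)) = outside (path_image c) \<union> path_image c"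
    unfolding closure_Un_frontier fr by (rule refl)+
qed (use Jordan_inside_outside[OF assms] in blast)+

lemma connected_off_Jordan_curve_cases:
  fixes S :: "complex set" and c :: "real \<Rightarrow> complex"
  assumes "connected S" "S \<inter> path_image c = {}"
  shows "S \<subseteq> inside (path_image c) \<or> S \<subseteq> outside (path_image c)"
  using inside_outside_intersect_connected[of S "path_image c"] assms
  using inside_Un_outside[of "path_image c"] by blast

text \<open>The closed outside of the curve \<open>c\<close> is connected, unbounded and disjoint from \<open>e\<close>, so it can only
  lie outside \<open>e\<close>.\<close>

lemma inside_Jordan_nested:
  fixes c e :: "real \<Rightarrow> complex"
  assumes c: "simple_path c" "pathfinish c = pathstart c"
    and e: "simple_path e" "pathfinish e = pathstart e"
    and sub: "path_image e \<subseteq> inside (path_image c)"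
  shows "inside (path_image e) \<subseteq> inside (path_image c)"
    and "path_image c \<subseteq> outside (path_image e)"
proof -
  let ?E = "outside (path_image c) \<union> path_image c"
  have dj: "?E \<inter> path_image e = {}"
    using sub inside_Int_outside[of "path_image c"] inside_no_overlap[of "path_image c"] by blast
  have con: "connected ?E"
    using connected_imp_connected_closure[OF Jordan_curve_sides(2)[OF c]] unfolding Jordan_curve_sides(4)[OF c] .
  have unb: "\<not> bounded ?E" using Jordan_curve_sides(5)[OF c] by simp
  have "?E \<subseteq> outside (path_image e)"
    using connected_off_Jordan_curve_cases[OF con dj] unb Jordan_curve_sides(6)[OF e] bounded_subset
    by blast
  then show "inside (path_image e) \<subseteq> inside (path_image c)"
    "path_image c \<subseteq> outside (path_image e)"
    using inside_Un_outside[of "path_image c"] inside_Int_outside[of "path_image e"] by blast+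
qed

text \<open>The closed inside of \<open>c\<close> is connected, disjoint from \<open>e\<close> and meets the outside of \<open>e\<close> along \<open>c\<close>
  itself, so it lies outside \<open>e\<close>.\<close>

lemma Jordan_insides_disjoint:
  fixes c e :: "real \<Rightarrow> complex"
  assumes c: "simple_path c" "pathfinish c = pathstart c"
    and e: "simple_path e" "pathfinish e = pathstart e"
    and ce: "path_image c \<subseteq> outside (path_image e)"
    and ec: "path_image e \<subseteq> outside (path_image c)"
  shows "inside (path_image c) \<inter> inside (path_image e) = {}"
proof -
  let ?E = "inside (path_image c) \<union> path_image c"
  have dj: "?E \<inter> path_image e = {}"
    using ce ec inside_Int_outside[of "path_image c"] outside_no_overlap[of "path_image e"] by blast
  have con: "connected ?E"
    using connected_imp_connected_closure[OF Jordan_curve_sides(1)[OF c]] unfolding Jordan_curve_sides(3)[OF c] .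
  have "?E \<subseteq> outside (path_image e)"
    using connected_off_Jordan_curve_cases[OF con dj] ce path_image_nonempty[of c]
      inside_Int_outside[of "path_image e"] by blast
  then show ?thesis using inside_Int_outside[of "path_image e"] by blast
qed

text \<open>Janiszewski's theorem, iterated: it applies to disjoint sets because their intersection, being
  empty, is connected. This is the planar fact that lets the boundary curves be treated one at a
  time.\<close>

lemma connected_component_off_disjoint_compact_sets:
  fixes \<F> :: "complex set set" and a b :: complex
  assumes "finite \<F>" "\<And>S. S \<in> \<F> \<Longrightarrow> compact S" "disjoint \<F>"
    "\<And>S. S \<in> \<F> \<Longrightarrow> connected_component (- S) a b"
  shows "connected_component (- \<Union>\<F>) a b"
  using assms
proof (induction \<F> rule: finite_induct)
  case empty
  show ?case using connected_UNIV by (auto simp: connected_component_def)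
next
  case (insert S \<F>)
  have dj: "S \<inter> \<Union>\<F> = {}"
    using insert.prems(2) insert.hyps(2) by (force simp: disjoint_def)
  have "connected_component (- (S \<union> \<Union>\<F>)) a b"
  proof (rule Janiszewski)
    show "compact S" using insert by blast
    have "compact (\<Union>\<F>)" using insert by (intro compact_Union) auto
    then show "closed (\<Union>\<F>)" by (rule compact_imp_closed)
    show "connected (S \<inter> \<Union>\<F>)" using dj by simp
    show "connected_component (- S) a b" using insert by blast
    show "connected_component (- \<Union>\<F>) a b"
      using insert by (auto simp: disjoint_def)
  qed
  then show ?case by simp
qed

context
  fixes D :: "complex set" and \<Gamma> :: "(real \<Rightarrow> complex) set"
  assumes D: "open D" "connected D" "bounded D" "D \<noteq> {}"
    and pob: "positively_oriented_boundary D \<Gamma>"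
begin

lemma boundary_curve:
  assumes "\<gamma> \<in> \<Gamma>"
  shows "valid_path \<gamma>" "simple_path \<gamma>" "pathfinish \<gamma> = pathstart \<gamma>" "path \<gamma>"
    "path_image \<gamma> \<subseteq> frontier D" "path_image \<gamma> \<inter> D = {}" "path_image \<gamma> \<subseteq> closure D"
proof -
  show a: "valid_path \<gamma>" "simple_path \<gamma>" "pathfinish \<gamma> = pathstart \<gamma>" "path_image \<gamma> \<subseteq> frontier D"
    using pob assms unfolding positively_oriented_boundary_def by auto
  then show "path \<gamma>" by (simp add: valid_path_imp_path)
  show "path_image \<gamma> \<inter> D = {}"  "path_image \<gamma> \<subseteq> closure D"
    using a D(1) by (auto simp: frontier_def interior_open)
qed

lemma boundary_curves_disjoint:
  assumes "\<gamma> \<in> \<Gamma>" "\<eta> \<in> \<Gamma>" "\<gamma> \<noteq> \<eta>" shows "path_image \<gamma> \<inter> path_image \<eta> = {}"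
  using pob assms unfolding positively_oriented_boundary_def by auto

lemma boundary_curve_side:
  assumes "\<gamma> \<in> \<Gamma>"
  shows "D \<subseteq> inside (path_image \<gamma>) \<or> D \<subseteq> outside (path_image \<gamma>)"
  using connected_off_Jordan_curve_cases[OF D(2)] boundary_curve(6)[OF assms] by blast

lemma other_curve_inside:
  assumes "\<gamma> \<in> \<Gamma>" "\<eta> \<in> \<Gamma>" "\<gamma> \<noteq> \<eta>" "D \<subseteq> inside (path_image \<gamma>)"
  shows "path_image \<eta> \<subseteq> inside (path_image \<gamma>)"
  using boundary_curve(7)[OF assms(2)] closure_mono[OF assms(4)] boundary_curves_disjoint[OF assms(1-3)]
    Jordan_curve_sides(3)[OF boundary_curve(2,3)[OF assms(1)]] by blast

lemma other_curve_outside: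
  assumes "\<gamma> \<in> \<Gamma>" "\<eta> \<in> \<Gamma>" "\<gamma> \<noteq> \<eta>" "D \<subseteq> outside (path_image \<gamma>)"
  shows "path_image \<eta> \<subseteq> outside (path_image \<gamma>)"
  using boundary_curve(7)[OF assms(2)] closure_mono[OF assms(4)] boundary_curves_disjoint[OF assms(1-3)]
    Jordan_curve_sides(4)[OF boundary_curve(2,3)[OF assms(1)]] by blast

text \<open>Points that no single boundary curve separates are not separated by all of them together, hence
  they are joined by a connected set that misses the frontier of \<open>D\<close>; such a set cannot leave \<open>D\<close>.\<close>

lemma same_sides_imp_in_domain:
  assumes a: "a \<in> D"
    and same: "\<And>\<gamma>. \<gamma> \<in> \<Gamma> \<Longrightarrow> (a \<in> inside (path_image \<gamma>) \<and> b \<in> inside (path_image \<gamma>)) \<or>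
      (a \<in> outside (path_image \<gamma>) \<and> b \<in> outside (path_image \<gamma>))"
  shows "b \<in> D"
proof -
  have fr: "(\<Union>\<gamma>\<in>\<Gamma>. path_image \<gamma>) = frontier D" and fin: "finite \<Gamma>"
    using pob unfolding positively_oriented_boundary_def by auto
  have "connected_component (- \<Union>(path_image ` \<Gamma>)) a b"
  proof (rule connected_component_off_disjoint_compact_sets)
    show "finite (path_image ` \<Gamma>)" using fin by simp
    show "compact S" if "S \<in> path_image ` \<Gamma>" for S
      using that boundary_curve(4) compact_path_image by blast
    show "disjoint (path_image ` \<Gamma>)"
      unfolding disjoint_def using boundary_curves_disjoint by blast
    show "connected_component (- S) a b" if S: "S \<in> path_image ` \<Gamma>" for S
    proof -
      obtain \<gamma> where g: "\<gamma> \<in> \<Gamma>" "S = path_image \<gamma>" using S by blast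
      note J = Jordan_curve_sides(1,2)[OF boundary_curve(2,3)[OF g(1)]]
      have "inside S \<subseteq> - S" "outside S \<subseteq> - S"
        using inside_no_overlap[of S] outside_no_overlap[of S] by blast+
      then show ?thesis
        using same[OF g(1)] J g(2) unfolding connected_component_def by metis
    qed
  qed
  then obtain T where T: "connected T" "T \<subseteq> - frontier D" "a \<in> T" "b \<in> T"
    using fr unfolding connected_component_def by auto
  show "b \<in> D"
    using connected_Int_frontier[OF T(1), of D] T a by blast
qed

text \<open>If \<open>D\<close> lay outside every curve, no curve would separate it from a point far away, although \<open>D\<close> is
  bounded. If it lay inside two curves, each of them would lie inside the other.\<close>

lemma unique_outer_boundary_curve:
  obtains \<gamma>0 where "\<gamma>0 \<in> \<Gamma>" "D \<subseteq> inside (path_image \<gamma>0)"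
    "\<And>\<gamma>. \<gamma> \<in> \<Gamma> \<Longrightarrow> \<gamma> \<noteq> \<gamma>0 \<Longrightarrow> D \<subseteq> outside (path_image \<gamma>)"
proof -
  have "\<exists>\<gamma>0\<in>\<Gamma>. D \<subseteq> inside (path_image \<gamma>0)"
  proof (rule ccontr)
    assume "\<not> ?thesis"
    then have out: "D \<subseteq> outside (path_image \<gamma>)" if "\<gamma> \<in> \<Gamma>" for \<gamma>
      using boundary_curve_side that by blast
    have "bounded (closure D)" using D(3) by (rule bounded_closure)
    then obtain r where r: "closure D \<subseteq> ball 0 r" using bounded_subset_ballD by blast
    obtain a where a: "a \<in> D" using D(4) by blast
    obtain b :: complex where b: "b \<notin> ball 0 r"
      by (metis UNIV_eq_I bounded_ball not_bounded_UNIV)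
    have "b \<in> D"
    proof (rule same_sides_imp_in_domain[OF a])
      fix \<gamma> assume g: "\<gamma> \<in> \<Gamma>"
      have "path_image \<gamma> \<subseteq> ball 0 r" using r boundary_curve(7)[OF g] by blast
      then have "b \<in> outside (path_image \<gamma>)"
        using outside_subset_convex[of "ball 0 r" "path_image \<gamma>"] b by auto
      then show "(a \<in> inside (path_image \<gamma>) \<and> b \<in> inside (path_image \<gamma>)) \<or>
          (a \<in> outside (path_image \<gamma>) \<and> b \<in> outside (path_image \<gamma>))"
        using out[OF g] a by blast
    qed
    then show False using b r closure_subset by blast
  qed
  then obtain \<gamma>0 where g0: "\<gamma>0 \<in> \<Gamma>" "D \<subseteq> inside (path_image \<gamma>0)" by blast
  show thesis
  proof (rule that[OF g0])
    fix \<gamma> assume g: "\<gamma> \<in> \<Gamma>" "\<gamma> \<noteq> \<gamma>0"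
    show "D \<subseteq> outside (path_image \<gamma>)"
    proof (rule ccontr)
      assume "\<not> ?thesis"
      then have "D \<subseteq> inside (path_image \<gamma>)" using boundary_curve_side[OF g(1)] by blast
      then have "path_image \<gamma>0 \<subseteq> inside (path_image \<gamma>)"
        using other_curve_inside g g0 by blast
      moreover have "path_image \<gamma>0 \<subseteq> outside (path_image \<gamma>)"
        using inside_Jordan_nested(2)[OF boundary_curve(2,3)[OF g0(1)] boundary_curve(2,3)[OF g(1)]]
          other_curve_inside g g0 by blast
      ultimately show False
        using path_image_nonempty[of \<gamma>0] inside_Int_outside[of "path_image \<gamma>"] by blast
    qed
  qed
qed

text \<open>All curves but one surround holes. The insides of the hole curves are pairwise disjoint and
  contained in the inside of the outer curve, and together with \<open>D\<close> and the hole curves they fill it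
  up. So a point off the closure of \<open>D\<close> is either outside every curve, or inside the outer curve and
  exactly one hole curve, and then the winding numbers 1 and -1 cancel.\<close>

lemma winding_number_oriented_boundary:
  assumes z: "z \<notin> frontier D"
  shows "(\<Sum>\<gamma>\<in>\<Gamma>. winding_number \<gamma> z) = (if z \<in> D then 1 else 0)"
proof -
  obtain \<gamma>0 where g0: "\<gamma>0 \<in> \<Gamma>" "D \<subseteq> inside (path_image \<gamma>0)"
    and holes: "\<And>\<gamma>. \<gamma> \<in> \<Gamma> \<Longrightarrow> \<gamma> \<noteq> \<gamma>0 \<Longrightarrow> D \<subseteq> outside (path_image \<gamma>)"
    using unique_outer_boundary_curve by blast
  have fin: "finite \<Gamma>" and
    wn: "\<And>\<gamma> w. \<gamma> \<in> \<Gamma> \<Longrightarrow> w \<in> inside (path_image \<gamma>) \<Longrightarrow>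
           winding_number \<gamma> w = (if D \<subseteq> inside (path_image \<gamma>) then 1 else -1)"
    using pob unfolding positively_oriented_boundary_def by blast+
  have wn_out: "winding_number \<gamma> w = 0" if "\<gamma> \<in> \<Gamma>" "w \<in> outside (path_image \<gamma>)" for \<gamma> w
    using winding_number_zero_in_outside boundary_curve that by blast
  have wn0: "winding_number \<gamma>0 w = 1" if "w \<in> inside (path_image \<gamma>0)" for w
    using wn[OF g0(1) that] g0(2) by simp
  have wnh: "winding_number \<gamma> w = -1" if "\<gamma> \<in> \<Gamma>" "\<gamma> \<noteq> \<gamma>0" "w \<in> inside (path_image \<gamma>)" for \<gamma> w
  proof -
    have "\<not> D \<subseteq> inside (path_image \<gamma>)"
      using holes[OF that(1,2)] D(4) inside_Int_outside[of "path_image \<gamma>"] by blast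
    then show ?thesis using wn[OF that(1,3)] by simp
  qed
  have side: "z \<in> inside (path_image \<gamma>) \<or> z \<in> outside (path_image \<gamma>)" if "\<gamma> \<in> \<Gamma>" for \<gamma>
    using z boundary_curve(5)[OF that] inside_Un_outside[of "path_image \<gamma>"] by blast
  have split: "(\<Sum>\<gamma>\<in>\<Gamma>. winding_number \<gamma> z) =
      winding_number \<gamma>0 z + (\<Sum>\<gamma>\<in>\<Gamma> - {\<gamma>0}. winding_number \<gamma> z)"
    using fin g0(1) by (rule sum.remove)
  consider "z \<in> D" | "z \<in> outside (path_image \<gamma>0)" "z \<notin> D" | "z \<in> inside (path_image \<gamma>0)" "z \<notin> D"
    using side[OF g0(1)] by blast
  then show ?thesis
  proof cases
    case 1
    have "(\<Sum>\<gamma>\<in>\<Gamma> - {\<gamma>0}. winding_number \<gamma> z) = 0"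
      using holes 1 wn_out by (intro sum.neutral) blast
    then show ?thesis using split wn0[of z] 1 g0(2) by auto
  next
    case 2
    have "(\<Sum>\<gamma>\<in>\<Gamma> - {\<gamma>0}. winding_number \<gamma> z) = 0"
    proof (intro sum.neutral ballI)
      fix \<gamma> assume g: "\<gamma> \<in> \<Gamma> - {\<gamma>0}"
      have "path_image \<gamma> \<subseteq> inside (path_image \<gamma>0)"
        using other_curve_inside[OF g0(1) _ _ g0(2)] g by blast
      then have "inside (path_image \<gamma>) \<subseteq> inside (path_image \<gamma>0)"
        using inside_Jordan_nested(1)[OF boundary_curve(2,3)[OF g0(1)] boundary_curve(2,3)[of \<gamma>]] g
        by blast
      then have "z \<in> outside (path_image \<gamma>)"
        using side[of \<gamma>] g 2 inside_Int_outside[of "path_image \<gamma>0"] by blast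
      then show "winding_number \<gamma> z = 0" using wn_out g by blast
    qed
    then show ?thesis using split wn_out[OF g0(1) 2(1)] 2(2) by simp
  next
    case 3
    obtain a where a: "a \<in> D" using D(4) by blast
    have "\<exists>\<gamma>1\<in>\<Gamma> - {\<gamma>0}. z \<in> inside (path_image \<gamma>1)"
    proof (rule ccontr)
      assume no: "\<not> ?thesis"
      have "z \<in> D"
      proof (rule same_sides_imp_in_domain[OF a])
        fix \<gamma> assume g: "\<gamma> \<in> \<Gamma>"
        show "(a \<in> inside (path_image \<gamma>) \<and> z \<in> inside (path_image \<gamma>)) \<or>
          (a \<in> outside (path_image \<gamma>) \<and> z \<in> outside (path_image \<gamma>))"
          using no side[OF g] holes[OF g] a g 3 g0 by blast
      qed
      with 3 show False by simp
    qed
    then obtain \<gamma>1 where g1: "\<gamma>1 \<in> \<Gamma> - {\<gamma>0}" "z \<in> inside (path_image \<gamma>1)" by blast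
    have "(\<Sum>\<gamma>\<in>\<Gamma> - {\<gamma>0}. winding_number \<gamma> z) =
        winding_number \<gamma>1 z + (\<Sum>\<gamma>\<in>\<Gamma> - {\<gamma>0} - {\<gamma>1}. winding_number \<gamma> z)"
      using fin g1(1) by (intro sum.remove) auto
    moreover have "(\<Sum>\<gamma>\<in>\<Gamma> - {\<gamma>0} - {\<gamma>1}. winding_number \<gamma> z) = 0"
    proof (intro sum.neutral ballI)
      fix \<gamma> assume g: "\<gamma> \<in> \<Gamma> - {\<gamma>0} - {\<gamma>1}"
      have "path_image \<gamma> \<subseteq> outside (path_image \<gamma>1)" "path_image \<gamma>1 \<subseteq> outside (path_image \<gamma>)"
        using other_curve_outside[of \<gamma>1 \<gamma>] other_curve_outside[of \<gamma> \<gamma>1]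
          holes[of \<gamma>] holes[of \<gamma>1] g g1 by auto
      then have "inside (path_image \<gamma>) \<inter> inside (path_image \<gamma>1) = {}"
        using Jordan_insides_disjoint[OF boundary_curve(2,3)[of \<gamma>] boundary_curve(2,3)[of \<gamma>1]]
          g g1(1) by blast
      then have "z \<in> outside (path_image \<gamma>)" using side[of \<gamma>] g g1 by blast
      then show "winding_number \<gamma> z = 0" using wn_out g by blast
    qed
    moreover have "winding_number \<gamma>1 z = -1" using wnh g1 by blast
    ultimately show ?thesis using split wn0[OF 3(1)] 3(2) by simp
  qed
qed

end


section \<open>The argument principle for an oriented boundary\<close>

text \<open>Each curve is attached to the base point by a path that is run through once in each direction, so
  that its contributions to any integral cancel. This reduces statements about cycles to statements
  about one closed path.\<close>

lemma cycle_as_single_loop: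
  fixes S :: "complex set" and \<Gamma> :: "(real \<Rightarrow> complex) set"
  assumes "finite \<Gamma>" "open S" "connected S" "a \<in> S"
    and "\<And>\<gamma>. \<gamma> \<in> \<Gamma> \<Longrightarrow> valid_path \<gamma> \<and> pathfinish \<gamma> = pathstart \<gamma> \<and> path_image \<gamma> \<subseteq> S"
  shows "\<exists>g. valid_path g \<and> pathstart g = a \<and> pathfinish g = a \<and> path_image g \<subseteq> S \<and>
    (\<forall>f. f holomorphic_on S \<longrightarrow> contour_integral g f = (\<Sum>\<gamma>\<in>\<Gamma>. contour_integral \<gamma> f))"
  using assms(1,5)
proof (induction \<Gamma> rule: finite_induct)
  case empty
  have "path_image (linepath a a) \<subseteq> S" using assms(4) by simp
  moreover have "contour_integral (linepath a a) f = (\<Sum>\<gamma>\<in>{}. contour_integral \<gamma> f)" for f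
    by (simp only: contour_integral_trivial sum.empty)
  ultimately show ?case
    using valid_path_linepath pathstart_linepath pathfinish_linepath by blast
next
  case (insert \<gamma> \<Gamma>)
  from insert obtain g where g: "valid_path g" "pathstart g = a" "pathfinish g = a" "path_image g \<subseteq> S"
    and gint: "\<And>f. f holomorphic_on S \<Longrightarrow> contour_integral g f = (\<Sum>\<gamma>\<in>\<Gamma>. contour_integral \<gamma> f)"
    by blast
  have c: "valid_path \<gamma>" "pathfinish \<gamma> = pathstart \<gamma>" "path_image \<gamma> \<subseteq> S"
    using insert.prems by auto
  have "pathstart \<gamma> \<in> S" using c(3) by auto
  then obtain p where p: "polynomial_function p" "path_image p \<subseteq> S" "pathstart p = a"
      "pathfinish p = pathstart \<gamma>"
    using connected_open_polynomial_connected[OF assms(2,3,4)] by blast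
  have vp: "valid_path p" using p(1) by (rule valid_path_polynomial_function)
  let ?l = "p +++ \<gamma> +++ reversepath p"
  have vl: "valid_path ?l" using vp c p by (intro valid_path_join) auto
  have il: "path_image ?l \<subseteq> S" using vp c p by (simp add: path_image_join)
  have sl: "pathstart ?l = a" "pathfinish ?l = a" using p by auto
  have "contour_integral (g +++ ?l) f = (\<Sum>\<gamma>\<in>insert \<gamma> \<Gamma>. contour_integral \<gamma> f)"
    if f: "f holomorphic_on S" for f
  proof -
    note ci = contour_integrable_holomorphic_simple[OF f assms(2)]
    have "contour_integral (g +++ ?l) f = contour_integral g f + contour_integral ?l f"
      using ci[OF g(1,4)] ci[OF vl il] g(1) vl by (intro contour_integral_join)
    also have "contour_integral ?l f =
        contour_integral p f + (contour_integral \<gamma> f + contour_integral (reversepath p) f)"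
      using ci[OF vp p(2)] ci[OF c(1,3)] vp c(1) p(4)
      by (simp add: contour_integrable_reversepath c(2))
    finally show ?thesis
      using insert.hyps gint[OF f] by (simp add: contour_integral_reversepath[OF vp])
  qed
  moreover have "valid_path (g +++ ?l)"
    using valid_path_join[OF g(1) vl] g(3) sl(1) by metis
  moreover have "path_image (g +++ ?l) \<subseteq> S" using g il sl by (subst path_image_join) auto
  ultimately show ?case using sl g(2) by (intro exI[of _ "g +++ ?l"]) auto
qed

text \<open>The curves are joined within the complement of the zeros. Winding numbers around the zeros and
  around points off the surrounding region are integrals of functions that are holomorphic on this
  complement, so the single loop has the winding numbers of the whole boundary: 1 around each zero,
  0 off the region. The middle conclusion says that \<open>H\<close> vanishes identically near no point of \<open>D\<close>,
  by connectedness of \<open>D\<close>; without it orders of zeros would make no sense.\<close>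

lemma argument_principle_oriented_boundary:
  assumes D: "open D" "connected D" "bounded D" "D \<noteq> {}"
    and pob: "positively_oriented_boundary D \<Gamma>"
    and W: "open W" "closure D \<subseteq> W" and H: "H holomorphic_on W"
    and nz: "\<And>z. z \<in> frontier D \<Longrightarrow> H z \<noteq> 0"
  shows "finite {z \<in> D. H z = 0}"
    and "\<And>z. z \<in> D \<Longrightarrow> \<forall>\<^sub>F w in at z. H w \<noteq> 0"
    and "(\<Sum>\<gamma>\<in>\<Gamma>. contour_integral \<gamma> (\<lambda>z. deriv H z / H z)) =
      2 * of_real pi * \<i> * (\<Sum>z | z \<in> D \<and> H z = 0. of_int (zorder H z))"
proof -
  have clD: "closure D = D \<union> frontier D"
    by (rule closure_Un_frontier)
  \<comment> \<open>\<open>W\<close> may contain zeros outside \<open>D\<close>; the rest is the union of \<open>D\<close> and the set where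
    \<open>H\<close> does not vanish, and so is still open and contains the closure of \<open>D\<close>.\<close>
  define V where "V = W - {z \<in> W - D. H z = 0}"
  have V_eq: "V = D \<union> {z \<in> W. H z \<noteq> 0}"
    unfolding V_def using W(2) clD by auto
  have "open {z \<in> W. H z \<noteq> 0}"
  proof -
    have "open (W \<inter> H -` (- {0}))"
      using holomorphic_on_imp_continuous_on[OF H] W(1)
      by (intro continuous_open_preimage) auto
    moreover have "{z \<in> W. H z \<noteq> 0} = W \<inter> H -` (- {0})" by auto
    ultimately show ?thesis by simp
  qed
  then have oV: "open V" unfolding V_eq using D(1) by blast
  have clV: "closure D \<subseteq> V" unfolding V_eq clD using nz W(2) clD by blast
  obtain a where a: "a \<in> D" using D(4) by blast
  define S where "S = connected_component_set V a"
  have oS: "open S" unfolding S_def using oV by (rule open_connected_component)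
  have cS: "connected S" unfolding S_def by (rule connected_connected_component)
  have clS: "closure D \<subseteq> S"
    unfolding S_def using a clV closure_subset D(2)
    by (intro connected_component_maximal connected_imp_connected_closure) auto
  have SV: "S \<subseteq> V" unfolding S_def by (rule connected_component_subset)
  have SW: "S \<subseteq> W" using SV unfolding V_def by blast
  have DS: "D \<subseteq> S" using clS closure_subset by blast
  have HS: "H holomorphic_on S" using H SW by (rule holomorphic_on_subset)
  have zeros: "{z \<in> S. H z = 0} = {z \<in> D. H z = 0}"
    using SV DS unfolding V_eq by auto
  have "frontier D \<noteq> {}" using D not_bounded_UNIV frontier_eq_empty by blast
  then obtain b where b: "b \<in> frontier D" by blast
  have bS: "b \<in> S" "H b \<noteq> 0" using b nz clS clD by auto
  \<comment> \<open>The frontier point \<open>b\<close> shows that \<open>H\<close> is not identically zero on the connected set \<open>S\<close>.\<close>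
  have iso: "\<exists>r>0. \<forall>w\<in>ball z r - {z}. H w \<noteq> 0" if z: "z \<in> S" "H z = 0" for z
    using isolated_zeros[OF HS oS cS z bS] by metis
  show fin: "finite {z \<in> D. H z = 0}"
  proof (cases "H constant_on S")
    case True
    then have "H z \<noteq> 0" if "z \<in> S" for z
      using bS that unfolding constant_on_def by auto
    then have "{z \<in> D. H z = 0} = {}" using DS by blast
    then show ?thesis by (simp only: finite.emptyI)
  next
    case False
    have "compact (closure D)" using D(3) by (simp add: compact_closure)
    then have "finite {z \<in> closure D. H z = 0}"
      using holomorphic_compact_finite_zeros[OF HS oS cS _ clS False] by blast
    moreover have "{z \<in> D. H z = 0} \<subseteq> {z \<in> closure D. H z = 0}" using closure_subset by blast
    ultimately show ?thesis by (rule rev_finite_subset)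
  qed
  show "\<forall>\<^sub>F w in at z. H w \<noteq> 0" if z: "z \<in> D" for z
  proof (cases "H z = 0")
    case True
    obtain r where r: "r > 0" "\<forall>w\<in>ball z r - {z}. H w \<noteq> 0" using iso[of z] z DS True by blast
    then show ?thesis
      unfolding eventually_at by (intro exI[of _ r]) (auto simp: dist_commute)
  next
    case False
    have "continuous (at z) H"
      using holomorphic_on_imp_continuous_on[OF HS] oS z DS by (meson continuous_on_eq_continuous_at subsetD)
    then show ?thesis
      using False by (simp add: continuous_within tendsto_imp_eventually_ne)
  qed
  define Z where "Z = {z \<in> D. H z = 0}"
  have oSZ: "open (S - Z)" using oS fin unfolding Z_def by (simp add: open_Diff finite_imp_closed)
  have cSZ: "connected (S - Z)"
    using connected_open_delete_finite[OF oS cS] fin unfolding Z_def by simp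
  have "finite \<Gamma>" using pob unfolding positively_oriented_boundary_def by blast
  have curve: "valid_path \<gamma> \<and> pathfinish \<gamma> = pathstart \<gamma> \<and> path_image \<gamma> \<subseteq> S - Z" if g: "\<gamma> \<in> \<Gamma>" for \<gamma>
    using boundary_curve[OF D pob g] clS unfolding Z_def by blast
  obtain g where g: "valid_path g" "pathstart g = b" "pathfinish g = b" "path_image g \<subseteq> S - Z"
    and gint: "\<And>f. f holomorphic_on S - Z \<Longrightarrow> contour_integral g f = (\<Sum>\<gamma>\<in>\<Gamma>. contour_integral \<gamma> f)"
    using cycle_as_single_loop[OF \<open>finite \<Gamma>\<close> oSZ cSZ, of b] bS curve unfolding Z_def by blast
  have wn: "winding_number g z = (if z \<in> D then 1 else 0)" if z: "z \<notin> S - Z" for z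
  proof -
    have hol: "(\<lambda>w. 1 / (w - z)) holomorphic_on S - Z"
      using z by (intro holomorphic_intros) auto
    have "z \<notin> path_image g" using g(4) z by blast
    then have "winding_number g z = 1 / (2 * of_real pi * \<i>) * contour_integral g (\<lambda>w. 1 / (w - z))"
      using winding_number_valid_path[OF g(1)] by simp
    also have "\<dots> = (\<Sum>\<gamma>\<in>\<Gamma>. 1 / (2 * of_real pi * \<i>) * contour_integral \<gamma> (\<lambda>w. 1 / (w - z)))"
      using gint[OF hol] by (simp add: sum_distrib_left)
    also have "\<dots> = (\<Sum>\<gamma>\<in>\<Gamma>. winding_number \<gamma> z)"
    proof (intro sum.cong refl)
      fix \<gamma> assume "\<gamma> \<in> \<Gamma>"
      then have "valid_path \<gamma>" "z \<notin> path_image \<gamma>" using curve z by blast+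
      then show "1 / (2 * of_real pi * \<i>) * contour_integral \<gamma> (\<lambda>w. 1 / (w - z)) = winding_number \<gamma> z"
        using winding_number_valid_path by simp
    qed
    also have "\<dots> = (if z \<in> D then 1 else 0)"
      using z clS clD nz unfolding Z_def
      by (intro winding_number_oriented_boundary[OF D pob]) auto
    finally show ?thesis .
  qed
  have off: "\<forall>z. z \<notin> S \<longrightarrow> winding_number g z = 0" using wn DS by auto
  have Zeq: "{w \<in> S. H w = 0 \<or> w \<in> {}} = Z" using zeros unfolding Z_def by simp
  have "(\<Sum>\<gamma>\<in>\<Gamma>. contour_integral \<gamma> (\<lambda>z. deriv H z / H z)) = contour_integral g (\<lambda>z. deriv H z / H z)"
  proof (rule gint[symmetric])
    show "(\<lambda>z. deriv H z / H z) holomorphic_on S - Z"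
      using HS oSZ oS zeros unfolding Z_def
      by (intro holomorphic_intros holomorphic_deriv) (auto intro: holomorphic_on_subset)
  qed
  also have "contour_integral g (\<lambda>z. deriv H z / H z) = 2 * of_real pi * \<i> *
      (\<Sum>p | p \<in> S \<and> (H p = 0 \<or> p \<in> {}). winding_number g p * of_int (zorder H p))"
    using argument_principle[where f = H and poles = "{}" and h = "\<lambda>_. 1", OF oS cS _ _ g(1)]
      HS g(2-4) off fin zeros Zeq Z_def by simp
  also have "\<dots> = 2 * of_real pi * \<i> * (\<Sum>z\<in>Z. of_int (zorder H z))"
    unfolding Zeq using wn
    by (intro arg_cong2[where f = "(*)"] sum.cong refl) (auto simp: Z_def)
  finally show "(\<Sum>\<gamma>\<in>\<Gamma>. contour_integral \<gamma> (\<lambda>z. deriv H z / H z)) =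
      2 * of_real pi * \<i> * (\<Sum>z | z \<in> D \<and> H z = 0. of_int (zorder H z))"
    unfolding Z_def .
qed


section \<open>Complexified quaternions and holomorphic stems\<close>

text \<open>The complexification of the quaternions, whose additional imaginary unit \<open>\<iota>\<close> commutes with
  \<open>i\<close>, \<open>j\<close>, \<open>k\<close>. The two stem components of a slice function are the real and the imaginary part of a
  function \<open>\<alpha> + \<iota> \<beta>\<close> with values in this ring.\<close>

datatype biquat = Biquat (b0: complex) (b1: complex) (b2: complex) (b3: complex)

lemma biquat_eq_iff: "p = q \<longleftrightarrow> b0 p = b0 q \<and> b1 p = b1 q \<and> b2 p = b2 q \<and> b3 p = b3 q"
  by (cases p; cases q) simp

instantiation biquat :: ring_1
begin

definition zero_biquat :: biquat where "0 = Biquat 0 0 0 0"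

definition one_biquat :: biquat where "1 = Biquat 1 0 0 0"

definition plus_biquat :: "biquat \<Rightarrow> biquat \<Rightarrow> biquat" where
  "p + q = Biquat (b0 p + b0 q) (b1 p + b1 q) (b2 p + b2 q) (b3 p + b3 q)"

definition uminus_biquat :: "biquat \<Rightarrow> biquat" where
  "- p = Biquat (- b0 p) (- b1 p) (- b2 p) (- b3 p)"

definition minus_biquat :: "biquat \<Rightarrow> biquat \<Rightarrow> biquat" where
  "p - q = Biquat (b0 p - b0 q) (b1 p - b1 q) (b2 p - b2 q) (b3 p - b3 q)"

definition times_biquat :: "biquat \<Rightarrow> biquat \<Rightarrow> biquat" where
  "p * q = Biquat
     (b0 p * b0 q - b1 p * b1 q - b2 p * b2 q - b3 p * b3 q)
     (b0 p * b1 q + b1 p * b0 q + b2 p * b3 q - b3 p * b2 q)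
     (b0 p * b2 q - b1 p * b3 q + b2 p * b0 q + b3 p * b1 q)
     (b0 p * b3 q + b1 p * b2 q - b2 p * b1 q + b3 p * b0 q)"

instance
  by standard
    (simp_all add: biquat_eq_iff zero_biquat_def one_biquat_def plus_biquat_def uminus_biquat_def
      minus_biquat_def times_biquat_def algebra_simps)

end

lemma biquat_sel [simp]:
  "b0 0 = 0" "b1 0 = 0" "b2 0 = 0" "b3 0 = 0"
  "b0 1 = 1" "b1 1 = 0" "b2 1 = 0" "b3 1 = 0"
  "b0 (p + q) = b0 p + b0 q" "b1 (p + q) = b1 p + b1 q"
  "b2 (p + q) = b2 p + b2 q" "b3 (p + q) = b3 p + b3 q"
  "b0 (- p) = - b0 p" "b1 (- p) = - b1 p" "b2 (- p) = - b2 p" "b3 (- p) = - b3 p"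
  "b0 (p - q) = b0 p - b0 q" "b1 (p - q) = b1 p - b1 q"
  "b2 (p - q) = b2 p - b2 q" "b3 (p - q) = b3 p - b3 q"
  by (simp_all add: zero_biquat_def one_biquat_def plus_biquat_def uminus_biquat_def minus_biquat_def)

lemma biquat_times_sel:
  "b0 (p * q) = b0 p * b0 q - b1 p * b1 q - b2 p * b2 q - b3 p * b3 q"
  "b1 (p * q) = b0 p * b1 q + b1 p * b0 q + b2 p * b3 q - b3 p * b2 q"
  "b2 (p * q) = b0 p * b2 q - b1 p * b3 q + b2 p * b0 q + b3 p * b1 q"
  "b3 (p * q) = b0 p * b3 q + b1 p * b2 q - b2 p * b1 q + b3 p * b0 q"
  by (simp_all add: times_biquat_def)

definition bscalar :: "complex \<Rightarrow> biquat" where "bscalar c = Biquat c 0 0 0"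

definition bquat :: "quat \<Rightarrow> biquat" where
  "bquat q = Biquat (of_real (qre q)) (of_real (qi q)) (of_real (qj q)) (of_real (qk q))"

text \<open>The element \<open>p + \<iota> q\<close>.\<close>

definition bjoin :: "quat \<Rightarrow> quat \<Rightarrow> biquat" where
  "bjoin p q = Biquat (Complex (qre p) (qre q)) (Complex (qi p) (qi q))
     (Complex (qj p) (qj q)) (Complex (qk p) (qk q))"

definition breal :: "biquat \<Rightarrow> quat" where
  "breal B = Quat (Re (b0 B)) (Re (b1 B)) (Re (b2 B)) (Re (b3 B))"

definition bimag :: "biquat \<Rightarrow> quat" where
  "bimag B = Quat (Im (b0 B)) (Im (b1 B)) (Im (b2 B)) (Im (b3 B))"

text \<open>Only \<open>\<iota>\<close> changes sign here; this is not the conjugation of quaternions.\<close>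

definition bcnj :: "biquat \<Rightarrow> biquat" where
  "bcnj B = Biquat (cnj (b0 B)) (cnj (b1 B)) (cnj (b2 B)) (cnj (b3 B))"

text \<open>The image of \<open>p + \<iota> q\<close> when \<open>\<iota>\<close> is replaced by the imaginary unit \<open>v\<close>.\<close>

definition bval :: "quat \<Rightarrow> biquat \<Rightarrow> quat" where
  "bval v B = breal B + v * bimag B"

text \<open>The complex-bilinear extension of the squared norm of the quaternions, that is, \<open>\<Phi>\<close>. It is isotropic,
  and its null vectors will be the stem values at zeros.\<close>

definition bform :: "biquat \<Rightarrow> complex" where
  "bform B = (b0 B)\<^sup>2 + (b1 B)\<^sup>2 + (b2 B)\<^sup>2 + (b3 B)\<^sup>2"

lemma bscalar_sel [simp]: "b0 (bscalar c) = c" "b1 (bscalar c) = 0" "b2 (bscalar c) = 0" "b3 (bscalar c) = 0"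
  by (simp_all add: bscalar_def)

lemma bquat_sel [simp]: "b0 (bquat q) = of_real (qre q)" "b1 (bquat q) = of_real (qi q)"
  "b2 (bquat q) = of_real (qj q)" "b3 (bquat q) = of_real (qk q)"
  by (simp_all add: bquat_def)

lemma bscalar_mult: "bscalar (c * d) = bscalar c * bscalar d"
  by (simp add: biquat_eq_iff biquat_times_sel)

lemma breal_bjoin [simp]: "breal (bjoin p q) = p" and bimag_bjoin [simp]: "bimag (bjoin p q) = q"
  by (simp_all add: breal_def bimag_def bjoin_def quat_eq_iff)

lemma bjoin_breal_bimag [simp]: "bjoin (breal B) (bimag B) = B"
  by (simp add: breal_def bimag_def bjoin_def biquat_eq_iff)

lemma breal_mult: "breal (A * B) = breal A * breal B - bimag A * bimag B"
  and bimag_mult: "bimag (A * B) = breal A * bimag B + bimag A * breal B"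
  by (simp_all add: quat_eq_iff quat_times_sel biquat_times_sel breal_def bimag_def algebra_simps)

lemma bcnj_bjoin: "bcnj (bjoin p q) = bjoin p (- q)"
  by (simp add: bcnj_def bjoin_def biquat_eq_iff complex_eq_iff)

lemma breal_bcnj [simp]: "breal (bcnj B) = breal B" and bimag_bcnj [simp]: "bimag (bcnj B) = - bimag B"
  by (simp_all add: bcnj_def breal_def bimag_def quat_eq_iff)

lemma bcnj_mult: "bcnj (A * B) = bcnj A * bcnj B"
  by (simp add: bcnj_def biquat_eq_iff biquat_times_sel)

lemma bcnj_bscalar: "bcnj (bscalar c) = bscalar (cnj c)"
  by (simp add: bcnj_def biquat_eq_iff)

lemma bcnj_diff_bquat: "bcnj (bscalar c - bquat q) = bscalar (cnj c) - bquat q"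
  by (simp add: bcnj_def biquat_eq_iff)

text \<open>Euler's four-square identity is a polynomial identity and therefore survives complexification. It
  turns factorizations of stems into factorizations of a scalar holomorphic function.\<close>

lemma bform_mult: "bform (A * B) = bform A * bform B"
  unfolding bform_def biquat_times_sel by algebra

lemma bform_bscalar [simp]: "bform (bscalar c) = c\<^sup>2"
  by (simp add: bform_def)

lemma bform_bcnj: "bform (bcnj B) = cnj (bform B)"
  by (simp add: bform_def bcnj_def)

lemma Phi_hol_map: "(Phi \<circ> hol_map \<alpha> \<beta>) z = bform (bjoin (\<alpha> z) (\<beta> z))"
  by (simp add: Phi_def hol_map_def bform_def bjoin_def)

lemma imag_units_square: "v \<in> imag_units \<Longrightarrow> v * v = -1"
  by (simp add: imag_units_def power2_eq_square)

lemma imag_units_mult_left: "v \<in> imag_units \<Longrightarrow> v * (v * q) = - q"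
  by (metis imag_units_square mult.assoc mult_minus1)

lemma of_real_quat_commute: "of_real x * (q :: quat) = q * of_real x"
  by (simp add: quat_eq_iff quat_times_sel of_real_quat)

text \<open>Evaluation at \<open>v\<close> is not multiplicative, since \<open>v\<close> need not commute with the quaternions in the left
  factor. It is so when the left factor is a complex scalar, whose parts are real.\<close>

lemma bval_scalar_mult:
  assumes v: "v \<in> imag_units"
  shows "bval v (bscalar c * B) = slice_pt v c * bval v B"
proof -
  have 1: "breal (bscalar c) = of_real (Re c)" "bimag (bscalar c) = of_real (Im c)"
    by (simp_all add: breal_def bimag_def of_real_quat)
  have 3: "of_real x * (v * q) = v * (of_real x * q)" for x and q
    by (metis mult.assoc of_real_quat_commute)
  show ?thesis
    unfolding bval_def breal_mult bimag_mult 1 slice_pt_def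
    by (simp add: distrib_left distrib_right 3 mult.assoc imag_units_mult_left[OF v])
qed

lemma bval_bscalar: "v \<in> imag_units \<Longrightarrow> bval v (bscalar c) = slice_pt v c"
  by (simp add: bval_def breal_def bimag_def slice_pt_def of_real_quat)

lemma slice_pt_mult:
  assumes "v \<in> imag_units"
  shows "slice_pt v (c * d) = slice_pt v c * slice_pt v d"
  using bval_scalar_mult[OF assms, of c "bscalar d"] by (simp add: bval_bscalar assms flip: bscalar_mult)

lemma slice_pt_simps:
  "slice_pt v 1 = 1" "slice_pt v (of_real x) = of_real x"
  "slice_pt v (c + d) = slice_pt v c + slice_pt v d" "slice_pt v (c - d) = slice_pt v c - slice_pt v d"
  by (simp_all add: slice_pt_def algebra_simps)

lemma slice_pt_power: "v \<in> imag_units \<Longrightarrow> slice_pt v (c ^ n) = slice_pt v c ^ n"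
  by (induction n) (simp_all add: slice_pt_simps slice_pt_mult)

lemma norm_imag_unit: "v \<in> imag_units \<Longrightarrow> norm v = 1"
  using imag_unitsD by (simp add: norm_quat_def inner_quat_def power2_eq_square)

text \<open>For \<open>B = p + \<iota> q\<close> the form is \<open>\<bar>p\<bar>\<^sup>2 - \<bar>q\<bar>\<^sup>2 + 2 \<iota> \<langle>p, q\<rangle>\<close>. If \<open>q\<close> is non-zero, its vanishing says precisely
  that \<open>- p q\<^sup>-\<^sup>1\<close> has norm 1 and real part 0. Hence \<open>\<Phi> \<circ> F\<close> vanishes at \<open>z\<close> if and only if the slice
  function has a zero somewhere on the sphere of \<open>z\<close>.\<close>

lemma bform_eq_0_iff: "bform B = 0 \<longleftrightarrow> (\<exists>v\<in>imag_units. bval v B = 0)"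
proof -
  let ?p = "breal B" and ?q = "bimag B"
  have form: "bform B = Complex (inner ?p ?p - inner ?q ?q) (2 * inner ?p ?q)"
    by (simp add: bform_def inner_quat_def breal_def bimag_def complex_eq_iff power2_eq_square)
  show ?thesis
  proof
    assume "bform B = 0"
    then have e: "inner ?p ?p = inner ?q ?q" "inner ?p ?q = 0"
      unfolding form by (auto simp: complex_eq_iff)
    show "\<exists>v\<in>imag_units. bval v B = 0"
    proof (cases "?q = 0")
      case True
      then have "?p = 0" using e by simp
      then show ?thesis using True imag_units_nonempty by (auto simp: bval_def)
    next
      case False
      \<comment> \<open>the unique solution of \<open>p + v q = 0\<close>\<close>
      define v where "v = - (?p * inverse ?q)"
      have "?p * inverse ?q * ?q = ?p" using False by (simp add: mult.assoc)
      then have z: "bval v B = 0" by (simp add: bval_def v_def)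
      have n: "norm v = 1"
        using e False unfolding v_def by (simp add: norm_mult norm_inverse norm_eq_sqrt_inner[of ?p] norm_eq_sqrt_inner[of ?q])
      have "qre (?p * inverse ?q) = inner ?p ?q / inner ?q ?q"
        by (simp add: inverse_quat_def inner_quat_def quat_times_sel field_simps)
      then have r: "qre v = 0" using e by (simp add: v_def)
      have "qre v * qre v + qi v * qi v + qj v * qj v + qk v * qk v = 1"
        using n unfolding norm_quat_def inner_quat_def by simp
      then have "v\<^sup>2 = -1"
        using r by (simp add: quat_eq_iff quat_times_sel power2_eq_square)
      then show ?thesis using z by (auto simp: imag_units_def)
    qed
  next
    assume "\<exists>v\<in>imag_units. bval v B = 0"
    then obtain v where v: "v \<in> imag_units" "?p = - (v * ?q)"
      by (auto simp: bval_def add_eq_0_iff2)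
    have vs: "qre v = 0" "qi v * qi v + qj v * qj v + qk v * qk v = 1"
      using imag_unitsD[OF v(1)] by (auto simp: power2_eq_square)
    have "norm ?p = norm ?q" using v by (simp add: norm_mult norm_imag_unit)
    then have "inner ?p ?p = inner ?q ?q" by (simp add: norm_eq_sqrt_inner)
    moreover have "inner ?p ?q = 0"
      unfolding v(2) by (simp add: inner_quat_def quat_times_sel vs(1) algebra_simps)
    ultimately show "bform B = 0" unfolding form by (simp add: complex_eq_iff)
  qed
qed

definition holomorphic_stem :: "complex set \<Rightarrow> (complex \<Rightarrow> biquat) \<Rightarrow> bool" where
  "holomorphic_stem V F \<longleftrightarrow>
     (\<lambda>z. b0 (F z)) holomorphic_on V \<and> (\<lambda>z. b1 (F z)) holomorphic_on V \<and>
     (\<lambda>z. b2 (F z)) holomorphic_on V \<and> (\<lambda>z. b3 (F z)) holomorphic_on V \<and>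
     (\<forall>z\<in>V. F (cnj z) = bcnj (F z))"

text \<open>\<open>f\<close> is the slice function with stem \<open>F\<close>. With both stem components in one ring, the Cauchy-Riemann
  equations become holomorphy and the \<open>\<star>\<close>-product becomes the pointwise product of stems.\<close>

definition induces :: "complex set \<Rightarrow> (complex \<Rightarrow> biquat) \<Rightarrow> (quat \<Rightarrow> quat) \<Rightarrow> bool" where
  "induces V F f \<longleftrightarrow>
     holomorphic_stem V F \<and> (\<forall>z\<in>V. \<forall>v\<in>imag_units. f (slice_pt v z) = bval v (F z))"

lemma partials_has_derivative:
  assumes "(g has_derivative A) (at z)"
  shows "partial_x g z = A 1" "partial_y g z = A \<i>"
proof -
  have "((\<lambda>t. g (Complex t (Im z))) has_vector_derivative A 1) (at (Re z))"
  proof -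
    have h: "((\<lambda>t. Complex t (Im z)) has_vector_derivative 1) (at (Re z))"
      unfolding Complex_eq by (auto intro!: derivative_eq_intros)
    have "((g \<circ> (\<lambda>t. Complex t (Im z))) has_vector_derivative A 1) (at (Re z))"
      using vector_derivative_diff_chain_within[OF h, of g A] assms
      by (simp add: has_derivative_at_withinI)
    then show ?thesis by (simp add: o_def)
  qed
  then show "partial_x g z = A 1" unfolding partial_x_def by (rule vector_derivative_at)
  have "((\<lambda>t. g (Complex (Re z) t)) has_vector_derivative A \<i>) (at (Im z))"
  proof -
    have h: "((\<lambda>t. Complex (Re z) t) has_vector_derivative \<i>) (at (Im z))"
      unfolding Complex_eq by (auto intro!: derivative_eq_intros)
    have "((g \<circ> (\<lambda>t. Complex (Re z) t)) has_vector_derivative A \<i>) (at (Im z))"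
      using vector_derivative_diff_chain_within[OF h, of g A] assms
      by (simp add: has_derivative_at_withinI)
    then show ?thesis by (simp add: o_def)
  qed
  then show "partial_y g z = A \<i>" unfolding partial_y_def by (rule vector_derivative_at)
qed

lemma linear_complex_expand:
  fixes A :: "complex \<Rightarrow> quat"
  assumes "linear A"
  shows "A h = Re h *\<^sub>R A 1 + Im h *\<^sub>R A \<i>"
proof -
  have "h = Re h *\<^sub>R 1 + Im h *\<^sub>R \<i>" by (simp add: complex_eq_iff)
  then show ?thesis using linear_add[OF assms] linear_scale[OF assms] by metis
qed

lemma bounded_linear_quat_sel:
  "bounded_linear qre" "bounded_linear qi" "bounded_linear qj" "bounded_linear qk"
proof -
  have *: "\<bar>qre q\<bar> \<le> norm q \<and> \<bar>qi q\<bar> \<le> norm q \<and> \<bar>qj q\<bar> \<le> norm q \<and> \<bar>qk q\<bar> \<le> norm q" for q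
    unfolding norm_quat_def inner_quat_def power2_eq_square[symmetric]
    by (intro conjI real_le_rsqrt) auto
  show "bounded_linear qre" "bounded_linear qi" "bounded_linear qj" "bounded_linear qk"
    by (rule bounded_linear_intro[where K = 1]; use * in simp)+
qed

text \<open>By the Cauchy-Riemann equations the real derivative of each complexified component is
  multiplication by a complex number.\<close>

lemma holomorphic_Complex_of_CR:
  fixes \<alpha> \<beta> :: "complex \<Rightarrow> quat" and sel :: "quat \<Rightarrow> real"
  assumes "open V" "bounded_linear sel" "\<alpha> differentiable_on V" "\<beta> differentiable_on V"
    and CR: "\<And>z. z \<in> V \<Longrightarrow> partial_x \<alpha> z = partial_y \<beta> z \<and> partial_y \<alpha> z = - partial_x \<beta> z"
  shows "(\<lambda>z. Complex (sel (\<alpha> z)) (sel (\<beta> z))) holomorphic_on V"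
proof (rule holomorphic_onI)
  fix z assume z: "z \<in> V"
  interpret sel: bounded_linear sel using assms(2) .
  have "\<alpha> differentiable at z" "\<beta> differentiable at z"
    using assms(1,3,4) z by (metis at_within_open differentiable_on_def)+
  then obtain A B where A: "(\<alpha> has_derivative A) (at z)" and B: "(\<beta> has_derivative B) (at z)"
    unfolding differentiable_def by blast
  have e: "A 1 = B \<i>" "A \<i> = - B 1"
    using CR[OF z] partials_has_derivative[OF A] partials_has_derivative[OF B] by auto
  have "((\<lambda>z. of_real (sel (\<alpha> z)) + \<i> * of_real (sel (\<beta> z))) has_derivative
      (\<lambda>h. of_real (sel (A h)) + \<i> * of_real (sel (B h)))) (at z)"
    using sel.has_derivative[OF A] sel.has_derivative[OF B]
    by (auto intro!: derivative_eq_intros)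
  moreover have "(\<lambda>h. of_real (sel (A h)) + \<i> * of_real (sel (B h))) =
      (*) (Complex (sel (A 1)) (sel (B 1)))"
  proof
    fix h
    have "A h = Re h *\<^sub>R A 1 - Im h *\<^sub>R B 1" "B h = Re h *\<^sub>R B 1 + Im h *\<^sub>R A 1"
      using linear_complex_expand[of A h] linear_complex_expand[of B h] e
        has_derivative_linear[OF A] has_derivative_linear[OF B] by auto
    then show "of_real (sel (A h)) + \<i> * of_real (sel (B h)) = Complex (sel (A 1)) (sel (B 1)) * h"
      by (simp add: sel.add sel.diff sel.scaleR complex_eq_iff)
  qed
  ultimately have "((\<lambda>z. Complex (sel (\<alpha> z)) (sel (\<beta> z))) has_field_derivative
      Complex (sel (A 1)) (sel (B 1))) (at z)"
    unfolding has_field_derivative_def Complex_eq by simp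
  then show "(\<lambda>z. Complex (sel (\<alpha> z)) (sel (\<beta> z))) field_differentiable at z within V"
    unfolding field_differentiable_def using has_field_derivative_at_within by blast
qed

lemma slice_stem_imp_induces:
  assumes "open V" "slice_stem V f \<alpha> \<beta>"
  shows "induces V (\<lambda>z. bjoin (\<alpha> z) (\<beta> z)) f"
  using assms(2) holomorphic_Complex_of_CR[OF assms(1) bounded_linear_quat_sel(1), of \<alpha> \<beta>]
    holomorphic_Complex_of_CR[OF assms(1) bounded_linear_quat_sel(2), of \<alpha> \<beta>]
    holomorphic_Complex_of_CR[OF assms(1) bounded_linear_quat_sel(3), of \<alpha> \<beta>]
    holomorphic_Complex_of_CR[OF assms(1) bounded_linear_quat_sel(4), of \<alpha> \<beta>]
  unfolding slice_stem_def induces_def holomorphic_stem_def bval_def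
  by (auto simp: bcnj_bjoin) (auto simp: bjoin_def)

lemma has_derivative_Quat:
  assumes "(f0 has_derivative g0) F" "(f1 has_derivative g1) F" "(f2 has_derivative g2) F"
    "(f3 has_derivative g3) F"
  shows "((\<lambda>z. Quat (f0 z) (f1 z) (f2 z) (f3 z)) has_derivative
    (\<lambda>h. Quat (g0 h) (g1 h) (g2 h) (g3 h))) F"
proof -
  have *: "Quat a b c d = a *\<^sub>R Quat 1 0 0 0 + b *\<^sub>R Quat 0 1 0 0 + c *\<^sub>R Quat 0 0 1 0 + d *\<^sub>R Quat 0 0 0 1"
    for a b c d by (simp add: quat_eq_iff)
  show ?thesis
    by (subst (1 2) *) (auto intro!: derivative_eq_intros assms)
qed

lemma induces_imp_slice_stem:
  assumes "open V" "induces V F f"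
  shows "slice_stem V f (\<lambda>z. breal (F z)) (\<lambda>z. bimag (F z))"
proof -
  have st: "holomorphic_stem V F" and val: "\<forall>z\<in>V. \<forall>v\<in>imag_units. f (slice_pt v z) = bval v (F z)"
    using assms(2) unfolding induces_def by auto
  have "\<exists>A B. ((\<lambda>z. breal (F z)) has_derivative A) (at z) \<and> ((\<lambda>z. bimag (F z)) has_derivative B) (at z) \<and>
      A 1 = B \<i> \<and> A \<i> = - B 1" if z: "z \<in> V" for z
  proof -
    have d: "\<exists>D. ((\<lambda>z. h z) has_derivative (*) D) (at z)" if "h holomorphic_on V" for h :: "complex \<Rightarrow> complex"
      using that z assms(1)
      by (metis at_within_open field_differentiable_def has_field_derivative_def holomorphic_on_def)
    obtain D0 D1 D2 D3 where D: "((\<lambda>z. b0 (F z)) has_derivative (*) D0) (at z)"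
       "((\<lambda>z. b1 (F z)) has_derivative (*) D1) (at z)" "((\<lambda>z. b2 (F z)) has_derivative (*) D2) (at z)"
       "((\<lambda>z. b3 (F z)) has_derivative (*) D3) (at z)"
      using st d unfolding holomorphic_stem_def by metis
    note Re = has_derivative_Re[OF D(1)] has_derivative_Re[OF D(2)] has_derivative_Re[OF D(3)] has_derivative_Re[OF D(4)]
    note Im = has_derivative_Im[OF D(1)] has_derivative_Im[OF D(2)] has_derivative_Im[OF D(3)] has_derivative_Im[OF D(4)]
    show ?thesis
      unfolding breal_def bimag_def
      using has_derivative_Quat[OF Re] has_derivative_Quat[OF Im]
      by (intro exI conjI) (assumption | simp add: quat_eq_iff)+
  qed
  then have CR: "(\<lambda>z. breal (F z)) differentiable at z \<and> (\<lambda>z. bimag (F z)) differentiable at z \<and>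
      partial_x (\<lambda>z. breal (F z)) z = partial_y (\<lambda>z. bimag (F z)) z \<and>
      partial_y (\<lambda>z. breal (F z)) z = - partial_x (\<lambda>z. bimag (F z)) z" if "z \<in> V" for z
    using that partials_has_derivative unfolding differentiable_def by metis
  show ?thesis
    unfolding slice_stem_def
    using CR st val by (auto simp: differentiable_on_def differentiable_at_withinI bval_def holomorphic_stem_def)
qed

lemma slice_regular_iff_induces:
  assumes "open V"
  shows "slice_regular V f \<longleftrightarrow> (\<exists>F. induces V F f)"
  unfolding slice_regular_def
  using slice_stem_imp_induces[OF assms] induces_imp_slice_stem[OF assms] by blast

lemma holomorphic_stem_subset:
  "holomorphic_stem V F \<Longrightarrow> U \<subseteq> V \<Longrightarrow> holomorphic_stem U F"
  unfolding holomorphic_stem_def by (auto intro: holomorphic_on_subset)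

lemma induces_subset: "induces V F f \<Longrightarrow> U \<subseteq> V \<Longrightarrow> induces U F f"
  unfolding induces_def by (auto intro: holomorphic_stem_subset)

lemma induces_unique:
  assumes "open V" "induces V F f" "induces V G f" "z \<in> V"
  shows "F z = G z"
  using slice_stem_unique[OF induces_imp_slice_stem[OF assms(1,2)] induces_imp_slice_stem[OF assms(1,3)] assms(4)]
  by (metis bjoin_breal_bimag)

text \<open>The only other representation of a point \<open>slice_pt v z\<close> with non-real \<open>z\<close> is by \<open>- v\<close> and \<open>cnj z\<close>, and
  there the symmetry of \<open>F\<close> gives the same value. At real points, where \<open>v\<close> is arbitrary, the symmetry
  makes the imaginary part of \<open>F\<close> vanish.\<close>

lemma holomorphic_stem_imp_induces:
  assumes "holomorphic_stem V F"
  obtains f where "induces V F f"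
proof -
  define f where "f q = (case SOME (v, z). v \<in> imag_units \<and> z \<in> V \<and> q = slice_pt v z of (v, z) \<Rightarrow> bval v (F z))" for q
  have "f (slice_pt v z) = bval v (F z)" if vz: "v \<in> imag_units" "z \<in> V" for v z
  proof -
    let ?P = "\<lambda>(w, u). w \<in> imag_units \<and> u \<in> V \<and> slice_pt v z = slice_pt w u"
    obtain w u where wu: "(SOME p. ?P p) = (w, u)" by fastforce
    have "?P (SOME p. ?P p)"
      by (rule someI[of ?P "(v, z)"]) (use vz in simp)
    then have w: "w \<in> imag_units" "u \<in> V" "slice_pt v z = slice_pt w u" unfolding wu by auto
    have sym: "F (cnj t) = bcnj (F t)" if "t \<in> V" for t
      using assms that unfolding holomorphic_stem_def by blast
    have re: "bimag (F t) = 0" if "t \<in> V" "Im t = 0" for t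
    proof -
      have "cnj t = t" using that by (simp add: complex_eq_iff)
      then have "bimag (F t) = - bimag (F t)" using sym[OF that(1)] by (metis bimag_bcnj)
      then show ?thesis by (simp add: quat_eq_iff)
    qed
    have "bval v (F z) = bval w (F u)"
      using w(3)[unfolded slice_pt_eq_iff[OF vz(1) w(1)]] sym[OF w(2)] re[OF w(2)] re[OF vz(2)]
      by (auto simp: bval_def)
    then show ?thesis unfolding f_def wu by simp
  qed
  then show thesis using that[of f] assms unfolding induces_def by blast
qed


section \<open>Dividing stems by polynomials\<close>

lemma holomorphic_stem_comp:
  assumes "holomorphic_stem V F"
  shows "(\<lambda>z. b0 (F z)) holomorphic_on V" "(\<lambda>z. b1 (F z)) holomorphic_on V"
    "(\<lambda>z. b2 (F z)) holomorphic_on V" "(\<lambda>z. b3 (F z)) holomorphic_on V"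
  using assms unfolding holomorphic_stem_def by auto

lemma holomorphic_stem_cnj: "holomorphic_stem V F \<Longrightarrow> z \<in> V \<Longrightarrow> F (cnj z) = bcnj (F z)"
  unfolding holomorphic_stem_def by auto

lemma holomorphic_on_bform:
  assumes "holomorphic_stem V F"
  shows "(\<lambda>z. bform (F z)) holomorphic_on V"
  unfolding bform_def by (intro holomorphic_intros holomorphic_stem_comp[OF assms])

lemma holomorphic_stem_mult:
  assumes "holomorphic_stem V F" "holomorphic_stem V G"
  shows "holomorphic_stem V (\<lambda>z. F z * G z)"
  using holomorphic_stem_comp[OF assms(1)] holomorphic_stem_comp[OF assms(2)]
  unfolding holomorphic_stem_def biquat_times_sel
  by (auto intro!: holomorphic_intros simp: bcnj_mult holomorphic_stem_cnj[OF assms(1)]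
      holomorphic_stem_cnj[OF assms(2)])

lemma holomorphic_stem_bscalar:
  assumes "P holomorphic_on V" "\<And>z. z \<in> V \<Longrightarrow> P (cnj z) = cnj (P z)"
  shows "holomorphic_stem V (\<lambda>z. bscalar (P z))"
  using assms unfolding holomorphic_stem_def by (auto simp: bcnj_bscalar)

lemma holomorphic_stem_linear: "holomorphic_stem V (\<lambda>w. bscalar w - bquat p)"
  unfolding holomorphic_stem_def by (auto intro!: holomorphic_intros simp: bcnj_diff_bquat)

text \<open>The real quadratic polynomial with the sphere of \<open>z\<close> as its zero set among the quaternions.\<close>

definition sphere_poly :: "complex \<Rightarrow> complex \<Rightarrow> complex" where
  "sphere_poly z w = (w - z) * (w - cnj z)"

lemma sphere_poly_eq: "sphere_poly z w = (w - of_real (Re z))\<^sup>2 + of_real ((Im z)\<^sup>2)"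
  by (simp add: sphere_poly_def complex_eq_iff power2_eq_square algebra_simps)

lemma sphere_poly_cnj: "sphere_poly z (cnj w) = cnj (sphere_poly z w)"
  by (simp add: sphere_poly_def mult.commute)

lemma holomorphic_sphere_poly [holomorphic_intros]: "sphere_poly z holomorphic_on V"
  unfolding sphere_poly_def by (intro holomorphic_intros)

lemma sphere_poly_eq_0_iff: "sphere_poly z w = 0 \<longleftrightarrow> w = z \<or> w = cnj z"
  by (auto simp: sphere_poly_def)

lemma slice_pt_sphere_poly:
  assumes "v \<in> imag_units"
  shows "slice_pt v (sphere_poly z w) =
    (slice_pt v w - of_real (Re z))\<^sup>2 + of_real ((Im z)\<^sup>2)"
  unfolding sphere_poly_eq
  by (simp only: slice_pt_simps slice_pt_power[OF assms])

lemma bquat_slice_pt_linear_mult: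
  assumes "v \<in> imag_units"
  shows "(bscalar w - bquat (slice_pt v z)) * (bscalar w - bquat (slice_pt v (cnj z))) =
    bscalar (sphere_poly z w)"
proof -
  have "(complex_of_real (qi v))\<^sup>2 + (of_real (qj v))\<^sup>2 + (of_real (qk v))\<^sup>2 = 1"
    using arg_cong[OF imag_unitsD(2)[OF assms], of complex_of_real] by simp
  then have e: "of_real (qi v * Im z) * of_real (qi v * Im z) +
      of_real (qj v * Im z) * of_real (qj v * Im z) + of_real (qk v * Im z) * of_real (qk v * Im z) =
      (of_real (Im z) :: complex)\<^sup>2"
    unfolding of_real_mult by algebra
  show ?thesis
    unfolding sphere_poly_eq biquat_eq_iff biquat_times_sel biquat_sel bscalar_sel bquat_sel
      slice_pt_sel[OF assms]
    using e by (simp add: algebra_simps power2_eq_square)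
qed

lemma bform_linear:
  assumes "p \<in> qsphere z"
  shows "bform (bscalar w - bquat p) = sphere_poly z w"
proof -
  obtain v where v: "v \<in> imag_units" "p = slice_pt v z" using assms unfolding qsphere_def by blast
  have "(complex_of_real (qi v))\<^sup>2 + (of_real (qj v))\<^sup>2 + (of_real (qk v))\<^sup>2 = 1"
    using arg_cong[OF imag_unitsD(2)[OF v(1)], of complex_of_real] by simp
  then have "(of_real (qi v * Im z))\<^sup>2 + (of_real (qj v * Im z))\<^sup>2 + (of_real (qk v * Im z))\<^sup>2 =
      (of_real (Im z) :: complex)\<^sup>2"
    unfolding of_real_mult by algebra
  then show ?thesis
    unfolding v(2) bform_def sphere_poly_eq biquat_sel bscalar_sel bquat_sel slice_pt_sel[OF v(1)]
    by (simp add: algebra_simps)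
qed

text \<open>If the value of \<open>B = p + \<iota> q\<close> at \<open>v\<close> is zero, then \<open>B = (\<iota> - v) q\<close>, while the left factor is a real
  multiple of \<open>\<iota> + v\<close>; and \<open>(\<iota> + v) (\<iota> - v) = 0\<close>.\<close>

lemma linear_conj_annihilates:
  assumes v: "v \<in> imag_units" and B: "bval v B = 0"
  shows "(bscalar z - bquat (slice_pt v (cnj z))) * B = 0"
proof -
  let ?C = "bscalar z - bquat (slice_pt v (cnj z))"
  have re: "breal ?C = of_real (Im z) * v" and im: "bimag ?C = of_real (Im z)"
    using imag_unitsD(1)[OF v]
    by (simp_all add: breal_def bimag_def quat_eq_iff slice_pt_sel[OF v] of_real_quat quat_times_sel)
  have B': "breal B = - (v * bimag B)" using B by (simp add: bval_def add_eq_0_iff2)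
  have "breal (?C * B) = 0" "bimag (?C * B) = 0"
    unfolding breal_mult bimag_mult re im B'
    by (simp_all add: mult.assoc imag_units_mult_left[OF v])
  then have "?C * B = bjoin 0 0" by (metis bjoin_breal_bimag)
  then show ?thesis by (simp add: bjoin_def biquat_eq_iff complex_eq_iff)
qed

lemma eq_off_finite_imp_eq:
  fixes f g :: "complex \<Rightarrow> complex"
  assumes "open W" "continuous_on W f" "continuous_on W g" "finite Z"
    and eq: "\<And>w. w \<in> W - Z \<Longrightarrow> f w = g w" and "z \<in> W"
  shows "f z = g z"
proof -
  have "isCont (\<lambda>w. f w - g w) z"
    using assms(1,2,3,6) by (intro continuous_diff) (auto simp: continuous_on_eq_continuous_at)
  then have l: "((\<lambda>w. f w - g w) \<longlongrightarrow> f z - g z) (at z)" by (simp add: isCont_def)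
  have "open (W - (Z - {z}))" using assms(1,4) by (intro open_Diff finite_imp_closed) auto
  then have "\<forall>\<^sub>F w in at z. w \<in> W - (Z - {z}) \<and> w \<noteq> z"
    using assms(6) unfolding eventually_at_topological
    by (intro exI[of _ "W - (Z - {z})"]) auto
  then have "\<forall>\<^sub>F w in at z. f w - g w = 0"
    by eventually_elim (use eq in auto)
  then have "((\<lambda>w. f w - g w) \<longlongrightarrow> 0) (at z)" by (rule tendsto_eventually)
  with l have "f z - g z = 0" using tendsto_unique by (metis at_neq_bot)
  then show ?thesis by simp
qed

lemma stem_eq_off_finite_imp_eq:
  assumes "open W" "holomorphic_stem W F" "holomorphic_stem W G" "finite Z"
    and "\<And>w. w \<in> W - Z \<Longrightarrow> F w = G w" and "z \<in> W"
  shows "F z = G z"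
proof -
  have *: "sel (F z) = sel (G z)"
    if "(\<lambda>z. sel (F z)) holomorphic_on W" "(\<lambda>z. sel (G z)) holomorphic_on W" for sel :: "biquat \<Rightarrow> complex"
    by (rule eq_off_finite_imp_eq[OF assms(1) _ _ assms(4) _ assms(6)])
      (simp_all add: that holomorphic_on_imp_continuous_on assms(5))
  show ?thesis
    unfolding biquat_eq_iff
    using *[of b0] *[of b1] *[of b2] *[of b3] holomorphic_stem_comp[OF assms(2)]
      holomorphic_stem_comp[OF assms(3)] by blast
qed

lemma bscalar_cancel:
  assumes "bscalar c * A = bscalar c * B" "c \<noteq> 0"
  shows "A = B"
  using assms by (simp add: biquat_eq_iff biquat_times_sel)

lemma bscalar_commute: "bscalar c * A = A * bscalar c"
  by (simp add: biquat_eq_iff biquat_times_sel)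

lemma holomorphic_divide_linear:
  assumes "open W" "f holomorphic_on W" "f a = 0"
  shows "\<exists>g. g holomorphic_on W \<and> (\<forall>z\<in>W. f z = (z - a) * g z)"
  using pole_lemma_open[OF assms(2,1), of a] assms(3)
  by (intro exI[of _ "\<lambda>z. if z = a then deriv f a else (f z - f a) / (z - a)"]) auto

text \<open>A quotient \<open>g\<close> need not be symmetric at the zeros of \<open>P\<close> a priori, but its average with the reflected
  function \<open>cnj \<circ> g \<circ> cnj\<close> is, and it is still a quotient.\<close>

lemma symmetric_quotient:
  assumes W: "symmetric_open W" and g: "g holomorphic_on W" "\<forall>z\<in>W. f z = P z * g z"
    and P: "\<And>z. P (cnj z) = cnj (P z)" and f: "\<And>z. z \<in> W \<Longrightarrow> f (cnj z) = cnj (f z)"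
  shows "\<exists>h. h holomorphic_on W \<and> (\<forall>z\<in>W. f z = P z * h z) \<and> (\<forall>z\<in>W. h (cnj z) = cnj (h z))"
proof -
  have oW: "open W" and sW: "cnj ` W = W" using W unfolding symmetric_open_def by auto
  have cW: "cnj z \<in> W" if "z \<in> W" for z using sW that by blast
  define h where "h z = (g z + cnj (g (cnj z))) / 2" for z
  have "(cnj \<circ> g \<circ> cnj) holomorphic_on W"
    using holomorphic_on_compose_cnj_cnj[of g W] g(1) sW oW by simp
  then have "h holomorphic_on W"
    unfolding h_def using g(1) by (intro holomorphic_intros) (auto simp: o_def)
  moreover have "f z = P z * h z" if z: "z \<in> W" for z
  proof -
    have "cnj (f (cnj z)) = f z" using f[OF z] by simp
    then have "P z * cnj (g (cnj z)) = f z" using g(2) cW[OF z] P[of z] by (metis complex_cnj_cnj complex_cnj_mult)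
    moreover have "P z * g z = f z" using g(2) z by simp
    ultimately show ?thesis unfolding h_def by (simp add: field_simps)
  qed
  moreover have "h (cnj z) = cnj (h z)" for z unfolding h_def by (simp add: add.commute)
  ultimately show ?thesis by blast
qed

lemma stem_quotient:
  assumes W: "symmetric_open W" and F: "holomorphic_stem W F"
    and P: "\<And>z. P (cnj z) = cnj (P z)"
    and zero: "F a = 0" and a: "a \<in> W"
    and quot: "\<And>f. f holomorphic_on W \<Longrightarrow> f a = 0 \<Longrightarrow> f (cnj a) = 0 \<Longrightarrow>
      \<exists>g. g holomorphic_on W \<and> (\<forall>z\<in>W. f z = P z * g z)"
  shows "\<exists>G. holomorphic_stem W G \<and> (\<forall>z\<in>W. F z = bscalar (P z) * G z)"
proof -
  have ca: "F (cnj a) = 0" using holomorphic_stem_cnj[OF F a] zero by (simp add: bcnj_def biquat_eq_iff)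
  have q: "\<exists>h. h holomorphic_on W \<and> (\<forall>z\<in>W. sel (F z) = P z * h z) \<and> (\<forall>z\<in>W. h (cnj z) = cnj (h z))"
    if hol: "(\<lambda>z. sel (F z)) holomorphic_on W" and s0: "sel 0 = 0"
      and sc: "\<And>B. sel (bcnj B) = cnj (sel B)" for sel :: "biquat \<Rightarrow> complex"
  proof -
    obtain g where g: "g holomorphic_on W" "\<forall>z\<in>W. sel (F z) = P z * g z"
      using quot[OF hol] zero ca s0 by auto
    show ?thesis
      using symmetric_quotient[OF W g P] holomorphic_stem_cnj[OF F] sc by auto
  qed
  note C = holomorphic_stem_comp[OF F]
  obtain h0 where h0: "h0 holomorphic_on W" "\<forall>z\<in>W. b0 (F z) = P z * h0 z" "\<forall>z\<in>W. h0 (cnj z) = cnj (h0 z)"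
    using q[OF C(1)] by (auto simp: bcnj_def)
  obtain h1 where h1: "h1 holomorphic_on W" "\<forall>z\<in>W. b1 (F z) = P z * h1 z" "\<forall>z\<in>W. h1 (cnj z) = cnj (h1 z)"
    using q[OF C(2)] by (auto simp: bcnj_def)
  obtain h2 where h2: "h2 holomorphic_on W" "\<forall>z\<in>W. b2 (F z) = P z * h2 z" "\<forall>z\<in>W. h2 (cnj z) = cnj (h2 z)"
    using q[OF C(3)] by (auto simp: bcnj_def)
  obtain h3 where h3: "h3 holomorphic_on W" "\<forall>z\<in>W. b3 (F z) = P z * h3 z" "\<forall>z\<in>W. h3 (cnj z) = cnj (h3 z)"
    using q[OF C(4)] by (auto simp: bcnj_def)
  show ?thesis
    using h0 h1 h2 h3
    by (intro exI[of _ "\<lambda>z. Biquat (h0 z) (h1 z) (h2 z) (h3 z)"])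
      (simp add: holomorphic_stem_def bcnj_def biquat_eq_iff biquat_times_sel)
qed

lemma stem_divide_real:
  assumes "symmetric_open W" "holomorphic_stem W F" "of_real x \<in> W" "F (of_real x) = 0"
  shows "\<exists>G. holomorphic_stem W G \<and> (\<forall>z\<in>W. F z = bscalar (z - of_real x) * G z)"
proof (rule stem_quotient[where P = "\<lambda>z. z - of_real x", OF assms(1,2) _ assms(4,3)])
  have "open W" using assms(1) unfolding symmetric_open_def by blast
  then show "\<exists>g. g holomorphic_on W \<and> (\<forall>z\<in>W. f z = (z - of_real x) * g z)"
    if "f holomorphic_on W" "f (of_real x) = 0" for f
    using holomorphic_divide_linear that by blast
qed simp

text \<open>By symmetry the stem vanishes at both \<open>a\<close> and its conjugate, so both linear factors of the polynomial
  can be divided out.\<close>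

lemma stem_divide_sphere:
  assumes W: "symmetric_open W" and F: "holomorphic_stem W F" "a \<in> W" "F a = 0" and a: "Im a \<noteq> 0"
  shows "\<exists>G. holomorphic_stem W G \<and> (\<forall>z\<in>W. F z = bscalar (sphere_poly a z) * G z)"
proof (rule stem_quotient[where P = "sphere_poly a", OF W F(1) sphere_poly_cnj F(3,2)])
  fix f assume f: "f holomorphic_on W" "f a = 0" "f (cnj a) = 0"
  have oW: "open W" and ca: "cnj a \<in> W" using W F(2) unfolding symmetric_open_def by blast+
  obtain g where g: "g holomorphic_on W" "\<forall>z\<in>W. f z = (z - a) * g z"
    using holomorphic_divide_linear[OF oW f(1,2)] by blast
  have "cnj a \<noteq> a" using a by (auto simp: complex_eq_iff)
  then have "g (cnj a) = 0" using g(2) ca f(3) by auto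
  then obtain h where h: "h holomorphic_on W" "\<forall>z\<in>W. g z = (z - cnj a) * h z"
    using holomorphic_divide_linear[OF oW g(1)] by blast
  show "\<exists>g. g holomorphic_on W \<and> (\<forall>z\<in>W. f z = sphere_poly a z * g z)"
    using g(2) h by (intro exI[of _ h]) (auto simp: sphere_poly_def)
qed

text \<open>The order at \<open>z\<close> measures the progress of repeated division: each extracted factor with a simple zero
  at \<open>z\<close> lowers it, and it never gets negative. The cofactor \<open>R\<close> is there because the
  quadratic polynomial of a sphere has a second zero.\<close>

lemma zorder_linear_power_mult:
  assumes W: "open W" "z \<in> W" and A: "A holomorphic_on W" and R: "R holomorphic_on W" "R z \<noteq> 0"
    and B: "\<And>w. w \<in> W \<Longrightarrow> B w = ((w - z) * R w) ^ j * A w"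
    and nz: "\<forall>\<^sub>F w in at z. B w \<noteq> 0"
  shows "zorder B z = int j + zorder A z" "\<forall>\<^sub>F w in at z. A w \<noteq> 0" "zorder A z \<ge> 0"
proof -
  have evW: "\<forall>\<^sub>F w in at z. w \<in> W"
    using W unfolding eventually_at_topological by blast
  show ev: "\<forall>\<^sub>F w in at z. A w \<noteq> 0"
    using nz evW by eventually_elim (use B in auto)
  have anA: "A analytic_on {z}" using A W analytic_at by blast
  have anR: "R analytic_on {z}" using R W analytic_at by blast
  show "zorder A z \<ge> 0"
    using anA eventually_frequently[OF _ ev] by (intro zorder_ge_0) auto
  have anL: "(\<lambda>w. ((w - z) * R w) ^ j) analytic_on {z}"
    using anR by (intro analytic_intros)
  have 1: "zorder (\<lambda>w. ((w - z) * R w) ^ j) z = int j"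
    using R W by (intro zorder_eqI[where S = W and g = "\<lambda>w. R w ^ j"])
      (auto intro!: holomorphic_intros simp: power_mult_distrib)
  have "\<forall>\<^sub>F w in at z. ((w - z) * R w) ^ j * A w \<noteq> 0"
    using nz evW by eventually_elim (use B in auto)
  then have "zorder (\<lambda>w. ((w - z) * R w) ^ j * A w) z = int j + zorder A z"
    using zorder_times_analytic[of "\<lambda>w. ((w - z) * R w) ^ j" z A] anA anR 1 anL by simp
  moreover have "zorder B z = zorder (\<lambda>w. ((w - z) * R w) ^ j * A w) z"
    using evW B by (intro zorder_cong) (auto elim: eventually_mono)
  ultimately show "zorder B z = int j + zorder A z" by simp
qed


section \<open>Local factorization at a zero and its multiplicities\<close>

text \<open>While the stem vanishes at \<open>z\<close>, a factor \<open>P\<close> can be divided out. Each division lowers the order of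
  \<open>bform \<circ> F\<close> at \<open>z\<close> by two, hence the process stops.\<close>

lemma stem_factor_out:
  assumes W: "open W" "z \<in> W" and R: "R holomorphic_on W" "R z \<noteq> 0"
    and P: "\<And>w. P w = (w - z) * R w"
    and quot: "\<And>F. holomorphic_stem W F \<Longrightarrow> F z = 0 \<Longrightarrow>
      \<exists>G. holomorphic_stem W G \<and> (\<forall>w\<in>W. F w = bscalar (P w) * G w)"
    and F: "holomorphic_stem W F" "\<forall>\<^sub>F w in at z. bform (F w) \<noteq> 0"
  shows "\<exists>m G. holomorphic_stem W G \<and> G z \<noteq> 0 \<and> (\<forall>w\<in>W. F w = bscalar (P w ^ m) * G w) \<and>
    (\<forall>\<^sub>F w in at z. bform (G w) \<noteq> 0)"
  using F
proof (induction "nat (zorder (\<lambda>w. bform (F w)) z)" arbitrary: F rule: less_induct)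
  case less
  show ?case
  proof (cases "F z = 0")
    case False
    moreover have "bscalar 1 = 1" by (simp add: biquat_eq_iff)
    ultimately show ?thesis using less.prems by (intro exI[of _ 0] exI[of _ F]) simp
  next
    case True
    obtain G where G: "holomorphic_stem W G" "\<forall>w\<in>W. F w = bscalar (P w) * G w"
      using quot[OF less.prems(1) True] by blast
    have "bform (F w) = ((w - z) * R w) ^ 2 * bform (G w)" if "w \<in> W" for w
      using G(2) that by (simp add: bform_mult P)
    note z = zorder_linear_power_mult[OF W holomorphic_on_bform[OF G(1)] R this less.prems(2)]
    have "nat (zorder (\<lambda>w. bform (G w)) z) < nat (zorder (\<lambda>w. bform (F w)) z)"
      using z(1,3) by simp
    then obtain m G' where G': "holomorphic_stem W G'" "G' z \<noteq> 0"
      "\<forall>w\<in>W. G w = bscalar (P w ^ m) * G' w" "\<forall>\<^sub>F w in at z. bform (G' w) \<noteq> 0"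
      using less.hyps[OF _ G(1) z(2)] by blast
    have "\<forall>w\<in>W. F w = bscalar (P w ^ Suc m) * G' w"
      using G(2) G'(3) by (simp add: bscalar_mult mult.assoc)
    then show ?thesis using G' by blast
  qed
qed

text \<open>Choose a zero \<open>p = x + v y\<close> on the sphere. Multiplying the stem from the left by \<open>w - x + v y\<close>
  makes it vanish at \<open>z\<close>, so the quadratic polynomial \<open>(w - p) (w - x + v y)\<close> can be divided out of the product,
  and cancelling it leaves \<open>w - p\<close> as a left factor.\<close>

lemma stem_divide_linear_factor:
  assumes W: "symmetric_open W" "z \<in> W" "Im z \<noteq> 0"
    and G: "holomorphic_stem W G" and zero: "bform (G z) = 0"
  shows "\<exists>p G'. p \<in> qsphere z \<and> holomorphic_stem W G' \<and> (\<forall>w\<in>W. G w = (bscalar w - bquat p) * G' w)"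
proof -
  have oW: "open W" using W(1) unfolding symmetric_open_def by blast
  obtain v where v: "v \<in> imag_units" "bval v (G z) = 0" using zero bform_eq_0_iff by blast
  let ?p = "slice_pt v z" and ?p' = "slice_pt v (cnj z)"
  have "holomorphic_stem W (\<lambda>w. (bscalar w - bquat ?p') * G w)"
    by (intro holomorphic_stem_mult holomorphic_stem_linear G)
  then obtain G' where G': "holomorphic_stem W G'"
    "\<forall>w\<in>W. (bscalar w - bquat ?p') * G w = bscalar (sphere_poly z w) * G' w"
    using stem_divide_sphere[OF W(1) _ W(2) _ W(3)] linear_conj_annihilates[OF v] by blast
  \<comment> \<open>Cancellation works off the two zeros of the polynomial; continuity covers these.\<close>
  have off: "G w = (bscalar w - bquat ?p) * G' w" if w: "w \<in> W - {z, cnj z}" for w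
  proof (rule bscalar_cancel)
    show "sphere_poly z w \<noteq> 0" using w by (simp add: sphere_poly_eq_0_iff)
    have "bscalar (sphere_poly z w) * G w =
        (bscalar w - bquat ?p) * ((bscalar w - bquat ?p') * G w)"
      by (simp only: bquat_slice_pt_linear_mult[OF v(1), symmetric] mult.assoc)
    also have "\<dots> = (bscalar w - bquat ?p) * (bscalar (sphere_poly z w) * G' w)"
      using G'(2) w by simp
    also have "\<dots> = bscalar (sphere_poly z w) * ((bscalar w - bquat ?p) * G' w)"
      by (metis bscalar_commute mult.assoc)
    finally show "bscalar (sphere_poly z w) * G w = bscalar (sphere_poly z w) * ((bscalar w - bquat ?p) * G' w)" .
  qed
  have "G w = (bscalar w - bquat ?p) * G' w" if "w \<in> W" for w
    using stem_eq_off_finite_imp_eq[OF oW G holomorphic_stem_mult[OF holomorphic_stem_linear G'(1)], of "{z, cnj z}"]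
      off that by blast
  moreover have "?p \<in> qsphere z" using v(1) unfolding qsphere_def by blast
  ultimately show ?thesis using G'(1) by blast
qed

text \<open>Each linear factor contributes one simple zero at \<open>z\<close> to \<open>bform \<circ> G\<close>, so the splitting stops after as
  many steps as the order of that function.\<close>

lemma stem_split_linear_factors:
  assumes W: "symmetric_open W" "z \<in> W" "Im z \<noteq> 0"
    and G: "holomorphic_stem W G" "\<forall>\<^sub>F w in at z. bform (G w) \<noteq> 0"
  shows "\<exists>ps G'. set ps \<subseteq> qsphere z \<and> holomorphic_stem W G' \<and> bform (G' z) \<noteq> 0 \<and>
    (\<forall>w\<in>W. G w = foldr (\<lambda>p u. (bscalar w - bquat p) * u) ps (G' w))"
  using G
proof (induction "nat (zorder (\<lambda>w. bform (G w)) z)" arbitrary: G rule: less_induct)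
  case less
  have oW: "open W" using W(1) unfolding symmetric_open_def by blast
  show ?case
  proof (cases "bform (G z) = 0")
    case False
    then show ?thesis using less.prems by (intro exI[of _ "[]"] exI[of _ G]) simp
  next
    case True
    obtain p G' where p: "p \<in> qsphere z" and G': "holomorphic_stem W G'"
      "\<forall>w\<in>W. G w = (bscalar w - bquat p) * G' w"
      using stem_divide_linear_factor[OF W less.prems(1) True] by blast
    have "bform (G w) = ((w - z) * (w - cnj z)) ^ 1 * bform (G' w)" if "w \<in> W" for w
      using G'(2) that by (simp add: bform_mult bform_linear[OF p] sphere_poly_def)
    note z = zorder_linear_power_mult[OF oW W(2) holomorphic_on_bform[OF G'(1)] _ _ this less.prems(2)]
    have "z - cnj z \<noteq> 0" using W(3) by (simp add: complex_eq_iff)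
    note z = z[OF _ this]
    have "(\<lambda>w. w - cnj z) holomorphic_on W" by (intro holomorphic_intros)
    note z = z[OF this]
    have "nat (zorder (\<lambda>w. bform (G' w)) z) < nat (zorder (\<lambda>w. bform (G w)) z)"
      using z(1,3) by simp
    then obtain ps G'' where G'': "set ps \<subseteq> qsphere z" "holomorphic_stem W G''" "bform (G'' z) \<noteq> 0"
      "\<forall>w\<in>W. G' w = foldr (\<lambda>p u. (bscalar w - bquat p) * u) ps (G'' w)"
      using less.hyps[OF _ G'(1) z(2)] by blast
    then show ?thesis using G'(2) p by (intro exI[of _ "p # ps"] exI[of _ G'']) auto
  qed
qed

lemma induces_linear: "induces V (\<lambda>w. bscalar w - bquat p) (\<lambda>q. q - p)"
  unfolding induces_def
  by (auto simp: holomorphic_stem_linear bval_def breal_def bimag_def quat_eq_iff quat_times_sel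
      slice_pt_sel imag_unitsD(1))

lemma induces_star:
  assumes "open V" "induces V F f" "induces V G g"
  shows "induces V (\<lambda>w. F w * G w) (star V f g)"
proof -
  have "star V f g (slice_pt v z) = bval v (F z * G z)" if "z \<in> V" "v \<in> imag_units" for z v
    using star_slice_pt[OF induces_imp_slice_stem[OF assms(1,2)] induces_imp_slice_stem[OF assms(1,3)] that]
    by (simp add: bval_def breal_mult bimag_mult)
  moreover have "holomorphic_stem V (\<lambda>w. F w * G w)"
    using assms(2,3) holomorphic_stem_mult unfolding induces_def by blast
  ultimately show ?thesis unfolding induces_def by blast
qed

lemma induces_star_linear_factors:
  assumes "open V" "induces V G g"
  shows "induces V (\<lambda>w. foldr (\<lambda>p u. (bscalar w - bquat p) * u) ps (G w))
    (foldr (\<lambda>p u. star V (\<lambda>q'. q' - p) u) ps g)"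
proof (induction ps)
  case (Cons p ps)
  show ?case using induces_star[OF assms(1) induces_linear Cons] by simp
qed (use assms in simp)

lemma bform_linear_factors:
  assumes "set ps \<subseteq> qsphere z"
  shows "bform (foldr (\<lambda>p u. (bscalar w - bquat p) * u) ps B) = sphere_poly z w ^ length ps * bform B"
  using assms by (induction ps) (auto simp: bform_mult bform_linear)

lemma induces_scalar_mult:
  assumes "induces V H h" "P holomorphic_on V" "\<And>z. z \<in> V \<Longrightarrow> P (cnj z) = cnj (P z)"
    and "\<And>z v. z \<in> V \<Longrightarrow> v \<in> imag_units \<Longrightarrow> f (slice_pt v z) = slice_pt v (P z) * h (slice_pt v z)"
  shows "induces V (\<lambda>z. bscalar (P z) * H z) f"
  using assms holomorphic_stem_mult[OF holomorphic_stem_bscalar[OF assms(2,3)]]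
  unfolding induces_def by (auto simp: bval_scalar_mult)

lemma bval_all_zero:
  assumes "\<And>v. v \<in> imag_units \<Longrightarrow> bval v B = 0"
  shows "B = 0"
proof -
  let ?v = "Quat 0 1 0 0"
  have "breal B + ?v * bimag B = 0" "breal B + (- ?v) * bimag B = 0"
    using assms[OF imag_units_nonempty] assms[OF imag_units_minus[OF imag_units_nonempty]]
    by (auto simp: bval_def)
  then have "breal B = 0" "bimag B = 0"
    by (auto simp: quat_eq_iff quat_times_sel)
  then have "B = bjoin 0 0" by (metis bjoin_breal_bimag)
  then show ?thesis by (simp add: bjoin_def biquat_eq_iff complex_eq_iff)
qed

text \<open>First all central factors are divided out, then the linear ones; the quotients are again stems
  and so induce slice-regular functions on the same open set.\<close>

lemma sphere_factorization_exists:
  assumes W: "symmetric_open W" "z \<in> W" "Im z \<noteq> 0"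
    and F: "induces W F f" "\<forall>\<^sub>F w in at z. bform (F w) \<noteq> 0"
  shows "\<exists>m n. sphere_factorization f z m n"
proof -
  have oW: "open W" using W(1) unfolding symmetric_open_def by blast
  have st: "holomorphic_stem W F" using F(1) unfolding induces_def by blast
  have R: "(\<lambda>w. w - cnj z) holomorphic_on W" by (intro holomorphic_intros)
  have Rz: "z - cnj z \<noteq> 0" using W(3) by (simp add: complex_eq_iff)
  obtain m G where G: "holomorphic_stem W G" "G z \<noteq> 0"
    "\<forall>w\<in>W. F w = bscalar (sphere_poly z w ^ m) * G w" "\<forall>\<^sub>F w in at z. bform (G w) \<noteq> 0"
    using stem_factor_out[OF oW W(2) R Rz sphere_poly_def stem_divide_sphere[OF W(1) _ W(2) _ W(3)] st F(2)]
    by blast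
  obtain ps G' where ps: "set ps \<subseteq> qsphere z" and G': "holomorphic_stem W G'" "bform (G' z) \<noteq> 0"
    "\<forall>w\<in>W. G w = foldr (\<lambda>p u. (bscalar w - bquat p) * u) ps (G' w)"
    using stem_split_linear_factors[OF W G(1,4)] by blast
  obtain h where h: "induces W G h" using holomorphic_stem_imp_induces[OF G(1)] .
  obtain g where g: "induces W G' g" using holomorphic_stem_imp_induces[OF G'(1)] .
  have hval: "h (slice_pt v w) = bval v (G w)" if "w \<in> W" "v \<in> imag_units" for v w
    using h that unfolding induces_def by blast
  have gval: "g (slice_pt v w) = bval v (G' w)" if "w \<in> W" "v \<in> imag_units" for v w
    using g that unfolding induces_def by blast
  have fval: "f (slice_pt v w) = bval v (F w)" if "w \<in> W" "v \<in> imag_units" for v w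
    using F(1) that unfolding induces_def by blast
  have "\<exists>q\<in>qsphere z. h q \<noteq> 0"
  proof -
    obtain v where "v \<in> imag_units" "bval v (G z) \<noteq> 0" using bval_all_zero[of "G z"] G(2) by blast
    then show ?thesis using hval[OF W(2)] unfolding qsphere_def by auto
  qed
  moreover have "\<forall>q\<in>qsphere z. g q \<noteq> 0"
    using G'(2) gval[OF W(2)] bform_eq_0_iff unfolding qsphere_def by auto
  moreover have "\<forall>q\<in>circularize W. f q = ((q - of_real (Re z))\<^sup>2 + of_real ((Im z)\<^sup>2)) ^ m * h q \<and>
      h q = foldr (\<lambda>p u. star W (\<lambda>q'. q' - p) u) ps g q"
  proof
    fix q assume "q \<in> circularize W"
    then obtain v w where vw: "v \<in> imag_units" "w \<in> W" "q = slice_pt v w"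
      unfolding circularize_def by blast
    have "f q = slice_pt v (sphere_poly z w ^ m) * h q"
      unfolding vw(3) fval[OF vw(2,1)] hval[OF vw(2,1)]
      using G(3) vw(2) by (simp add: bval_scalar_mult[OF vw(1)])
    also have "slice_pt v (sphere_poly z w ^ m) = ((q - of_real (Re z))\<^sup>2 + of_real ((Im z)\<^sup>2)) ^ m"
      unfolding vw(3) by (simp add: slice_pt_power[OF vw(1)] slice_pt_sphere_poly[OF vw(1)])
    finally have "f q = ((q - of_real (Re z))\<^sup>2 + of_real ((Im z)\<^sup>2)) ^ m * h q" .
    moreover have "h q = foldr (\<lambda>p u. star W (\<lambda>q'. q' - p) u) ps g q"
      using induces_star_linear_factors[OF oW g, of ps] hval[OF vw(2,1)] G'(3) vw
      unfolding induces_def by auto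
    ultimately show "f q = ((q - of_real (Re z))\<^sup>2 + of_real ((Im z)\<^sup>2)) ^ m * h q \<and>
      h q = foldr (\<lambda>p u. star W (\<lambda>q'. q' - p) u) ps g q" ..
  qed
  moreover have "slice_regular W h" "slice_regular W g"
    using h g slice_regular_iff_induces[OF oW] by blast+
  ultimately have "sphere_factorization f z m (length ps)"
    unfolding sphere_factorization_def using W ps by blast
  then show ?thesis by blast
qed

lemma symmetric_open_Int: "symmetric_open V \<Longrightarrow> symmetric_open W \<Longrightarrow> symmetric_open (V \<inter> W)"
  using image_Int[of cnj V W] by (simp add: symmetric_open_def inj_def open_Int)

text \<open>Stems are unique on a common domain, so a factorization of slice functions is a factorization of
  stems on a neighbourhood of \<open>z\<close>.\<close>

lemma sphere_factorization_stems:
  assumes W: "symmetric_open W" "z \<in> W" and F: "induces W F f"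
    and fac: "sphere_factorization f z m n"
  shows "\<exists>U H G. symmetric_open U \<and> z \<in> U \<and> holomorphic_stem U H \<and> holomorphic_stem U G \<and>
    H z \<noteq> 0 \<and> bform (G z) \<noteq> 0 \<and>
    (\<forall>w\<in>U. F w = bscalar (sphere_poly z w ^ m) * H w) \<and>
    (\<forall>w\<in>U. bform (H w) = sphere_poly z w ^ n * bform (G w))"
proof -
  obtain V h g ps where V: "symmetric_open V" "z \<in> V"
    and reg: "slice_regular V h" "slice_regular V g"
    and h0: "\<exists>q\<in>qsphere z. h q \<noteq> 0" and g0: "\<forall>q\<in>qsphere z. g q \<noteq> 0"
    and ps: "set ps \<subseteq> qsphere z" "length ps = n"
    and eq: "\<forall>q\<in>circularize V. f q = ((q - of_real (Re z))\<^sup>2 + of_real ((Im z)\<^sup>2)) ^ m * h q \<and>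
      h q = foldr (\<lambda>p u. star V (\<lambda>q'. q' - p) u) ps g q"
    using fac unfolding sphere_factorization_def by blast
  have oV: "open V" using V(1) unfolding symmetric_open_def by blast
  obtain H where H: "induces V H h" using reg(1) slice_regular_iff_induces[OF oV] by blast
  obtain G where G: "induces V G g" using reg(2) slice_regular_iff_induces[OF oV] by blast
  have circ: "slice_pt v w \<in> circularize V" if "w \<in> V" "v \<in> imag_units" for v w
    using that unfolding circularize_def by blast
  have "induces V (\<lambda>w. foldr (\<lambda>p u. (bscalar w - bquat p) * u) ps (G w)) h"
    using induces_star_linear_factors[OF oV G, of ps] eq circ unfolding induces_def by simp
  then have HG: "H w = foldr (\<lambda>p u. (bscalar w - bquat p) * u) ps (G w)" if "w \<in> V" for w
    using induces_unique[OF oV H] that by blast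
  have NF: "induces V (\<lambda>w. bscalar (sphere_poly z w ^ m) * H w) f"
  proof (rule induces_scalar_mult[OF H])
    show "(\<lambda>w. sphere_poly z w ^ m) holomorphic_on V" by (intro holomorphic_intros)
    show "sphere_poly z (cnj w) ^ m = cnj (sphere_poly z w ^ m)" for w by (simp add: sphere_poly_cnj)
    show "f (slice_pt v w) = slice_pt v (sphere_poly z w ^ m) * h (slice_pt v w)"
      if "w \<in> V" "v \<in> imag_units" for w v
      using eq circ[OF that] by (simp add: slice_pt_power[OF that(2)] slice_pt_sphere_poly[OF that(2)])
  qed
  let ?U = "V \<inter> W"
  have U: "symmetric_open ?U" "z \<in> ?U" using symmetric_open_Int V W by auto
  have oU: "open ?U" using U(1) unfolding symmetric_open_def by blast
  have "holomorphic_stem ?U H" "holomorphic_stem ?U G"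
    using H G holomorphic_stem_subset[of V _ ?U] unfolding induces_def by blast+
  moreover have "H z \<noteq> 0"
  proof
    assume 0: "H z = 0"
    have "bval v (H z) = 0" for v by (simp add: 0 bval_def breal_def bimag_def quat_eq_iff quat_times_sel)
    then show False using h0 H V(2) unfolding induces_def qsphere_def by auto
  qed
  moreover have "bform (G z) \<noteq> 0"
    using g0 G V(2) bform_eq_0_iff unfolding induces_def qsphere_def by auto
  moreover have "F w = bscalar (sphere_poly z w ^ m) * H w" if "w \<in> ?U" for w
    by (rule induces_unique[OF oU induces_subset[OF F] induces_subset[OF NF] that]) auto
  moreover have "bform (H w) = sphere_poly z w ^ n * bform (G w)" if "w \<in> ?U" for w
    using HG[of w] bform_linear_factors[OF ps(1)] ps(2) that by simp
  ultimately show ?thesis using U by meson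
qed

text \<open>A central factor enters \<open>bform\<close> squared, a linear one contributes the quadratic polynomial itself, and
  this polynomial has simple zeros at \<open>z\<close> and its conjugate.\<close>

lemma sphere_factorization_zorder:
  assumes W: "symmetric_open W" "z \<in> W" "Im z \<noteq> 0" and F: "induces W F f"
    and fac: "sphere_factorization f z m n"
  shows "zorder (\<lambda>w. bform (F w)) z = int (2 * m + n)"
    and "zorder (\<lambda>w. bform (F w)) (cnj z) = int (2 * m + n)"
proof -
  obtain U H G where U: "symmetric_open U" "z \<in> U" and st: "holomorphic_stem U H" "holomorphic_stem U G"
    and "H z \<noteq> 0" and Gz: "bform (G z) \<noteq> 0"
    and FH: "\<And>w. w \<in> U \<Longrightarrow> F w = bscalar (sphere_poly z w ^ m) * H w"
    and HG: "\<And>w. w \<in> U \<Longrightarrow> bform (H w) = sphere_poly z w ^ n * bform (G w)"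
    using sphere_factorization_stems[OF W(1,2) F fac] by fast
  have oU: "open U" and cU: "cnj z \<in> U" using U unfolding symmetric_open_def by blast+
  have ne: "z \<noteq> cnj z" using W(3) by (simp add: complex_eq_iff)
  have eq: "bform (F w) = sphere_poly z w ^ (2 * m + n) * bform (G w)" if "w \<in> U" for w
    using FH[OF that] HG[OF that] by (simp add: bform_mult power_add power_mult mult.assoc power2_eq_square power_mult_distrib)
  show "zorder (\<lambda>w. bform (F w)) z = int (2 * m + n)"
  proof (rule zorder_eqI[OF oU U(2)])
    show "(\<lambda>w. (w - cnj z) ^ (2 * m + n) * bform (G w)) holomorphic_on U"
      by (intro holomorphic_intros holomorphic_on_bform st)
    show "bform (F w) = (w - cnj z) ^ (2 * m + n) * bform (G w) * (w - z) powi int (2 * m + n)"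
      if "w \<in> U" for w
      unfolding eq[OF that] sphere_poly_def power_mult_distrib power_int_of_nat by (simp add: mult_ac)
  qed (use Gz ne in simp)
  show "zorder (\<lambda>w. bform (F w)) (cnj z) = int (2 * m + n)"
  proof (rule zorder_eqI[OF oU cU])
    show "(\<lambda>w. (w - z) ^ (2 * m + n) * bform (G w)) holomorphic_on U"
      by (intro holomorphic_intros holomorphic_on_bform st)
    show "bform (F w) = (w - z) ^ (2 * m + n) * bform (G w) * (w - cnj z) powi int (2 * m + n)"
      if "w \<in> U" for w
      unfolding eq[OF that] sphere_poly_def power_mult_distrib power_int_of_nat by (simp add: mult_ac)
    have "bform (G (cnj z)) \<noteq> 0"
      using holomorphic_stem_cnj[OF st(2) U(2)] Gz by (simp add: bform_bcnj)
    then show "(cnj z - z) ^ (2 * m + n) * bform (G (cnj z)) \<noteq> 0" using ne by simp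
  qed
qed

text \<open>If the second exponent were larger, cancellation would leave a positive power of the quadratic
  polynomial in the stem of the first cofactor, which would vanish at \<open>z\<close> and so on the whole sphere.\<close>

lemma sphere_factorization_le:
  assumes W: "symmetric_open W" "z \<in> W" and F: "induces W F f"
    and fac: "sphere_factorization f z m n" "sphere_factorization f z m' n'"
  shows "m' \<le> m"
proof (rule ccontr)
  assume less: "\<not> m' \<le> m"
  obtain U H where U: "symmetric_open U" "z \<in> U" and H: "holomorphic_stem U H" and Hz: "H z \<noteq> 0"
    and FH: "\<forall>w\<in>U. F w = bscalar (sphere_poly z w ^ m) * H w"
    using sphere_factorization_stems[OF W F fac(1)] by fast
  obtain U' H' where U': "symmetric_open U'" "z \<in> U'" and H': "holomorphic_stem U' H'"
    and FH': "\<forall>w\<in>U'. F w = bscalar (sphere_poly z w ^ m') * H' w"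
    using sphere_factorization_stems[OF W F fac(2)] by fast
  have o: "open (U \<inter> U')" using U(1) U'(1) unfolding symmetric_open_def by blast
  have N: "holomorphic_stem (U \<inter> U') (\<lambda>w. bscalar (sphere_poly z w ^ (m' - m)) * H' w)"
    by (intro holomorphic_stem_mult holomorphic_stem_bscalar holomorphic_intros holomorphic_stem_subset[OF H'])
      (auto simp: sphere_poly_cnj)
  have "H w = bscalar (sphere_poly z w ^ (m' - m)) * H' w" if w: "w \<in> U \<inter> U' - {z, cnj z}" for w
  proof (rule bscalar_cancel)
    show "sphere_poly z w ^ m \<noteq> 0" using w by (simp add: sphere_poly_eq_0_iff)
    have "sphere_poly z w ^ m' = sphere_poly z w ^ m * sphere_poly z w ^ (m' - m)"
      using less by (simp flip: power_add)
    then show "bscalar (sphere_poly z w ^ m) * H w =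
        bscalar (sphere_poly z w ^ m) * (bscalar (sphere_poly z w ^ (m' - m)) * H' w)"
      using FH FH' w by (metis DiffD1 IntE bscalar_mult mult.assoc)
  qed
  then have "H z = bscalar (sphere_poly z z ^ (m' - m)) * H' z"
    using stem_eq_off_finite_imp_eq[OF o holomorphic_stem_subset[OF H] N, of "{z, cnj z}" z] U(2) U'(2)
    by blast
  also have "\<dots> = 0" using less by (simp add: sphere_poly_def biquat_eq_iff biquat_times_sel)
  finally show False using Hz by simp
qed

text \<open>The first multiplicity is determined by the previous comparison of exponents; the second one then
  by the order of \<open>bform \<circ> F\<close>, which is twice the first plus the second.\<close>

lemma zorder_bform_nonreal:
  assumes W: "symmetric_open W" "z \<in> W" "Im z \<noteq> 0"
    and F: "induces W F f" "\<forall>\<^sub>F w in at z. bform (F w) \<noteq> 0"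
  shows "zorder (\<lambda>w. bform (F w)) z = int (2 * spherical_mult f z + isolated_mult f z)"
    and "zorder (\<lambda>w. bform (F w)) (cnj z) = int (2 * spherical_mult f z + isolated_mult f z)"
proof -
  obtain m n where mn: "sphere_factorization f z m n" using sphere_factorization_exists[OF assms] by blast
  have uniq: "m' = m \<and> n' = n" if "sphere_factorization f z m' n'" for m' n'
  proof -
    have "m' = m"
      using sphere_factorization_le[OF W(1,2) F(1) mn that] sphere_factorization_le[OF W(1,2) F(1) that mn] by simp
    then show ?thesis
      using sphere_factorization_zorder(1)[OF W F(1) mn] sphere_factorization_zorder(1)[OF W F(1) that] by simp
  qed
  have "spherical_mult f z = m" "isolated_mult f z = n"
    unfolding spherical_mult_def isolated_mult_def using mn uniq by blast+
  then show "zorder (\<lambda>w. bform (F w)) z = int (2 * spherical_mult f z + isolated_mult f z)"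
    "zorder (\<lambda>w. bform (F w)) (cnj z) = int (2 * spherical_mult f z + isolated_mult f z)"
    using sphere_factorization_zorder[OF W F(1) mn] by simp_all
qed

lemma slice_pt_real: "slice_pt v (of_real x) = of_real x"
  by (simp add: slice_pt_def)

text \<open>At a real point a stem takes real quaternion values, on which the form is the squared norm and hence
  definite.\<close>

lemma stem_real_bform:
  assumes "holomorphic_stem W G" "of_real x \<in> W"
  shows "bimag (G (of_real x)) = 0" "G (of_real x) \<noteq> 0 \<Longrightarrow> bform (G (of_real x)) \<noteq> 0"
proof -
  have "bimag (G (of_real x)) = - bimag (G (of_real x))"
    using holomorphic_stem_cnj[OF assms] by (metis bimag_bcnj complex_cnj_complex_of_real)
  then show im: "bimag (G (of_real x)) = 0" by (simp add: quat_eq_iff)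
  show "bform (G (of_real x)) \<noteq> 0" if nz: "G (of_real x) \<noteq> 0"
  proof
    assume "bform (G (of_real x)) = 0"
    then have "breal (G (of_real x)) = 0" using im by (auto simp: bform_eq_0_iff bval_def)
    then have "G (of_real x) = bjoin 0 0" using im by (metis bjoin_breal_bimag)
    then show False using nz by (simp add: bjoin_def biquat_eq_iff complex_eq_iff)
  qed
qed

text \<open>As the factor \<open>w - x\<close> is scalar, \<open>bform\<close> squares it. The remaining cofactor has non-zero form at \<open>x\<close>,
  since the form is definite on real quaternions.\<close>

lemma zorder_bform_real:
  assumes W: "symmetric_open W" "of_real x \<in> W"
    and F: "induces W F f" "\<forall>\<^sub>F w in at (of_real x). bform (F w) \<noteq> 0"
  shows "zorder (\<lambda>w. bform (F w)) (of_real x) = int (2 * real_zero_mult f x)"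
proof -
  let ?fac = "\<lambda>n. \<exists>V g. symmetric_open V \<and> of_real x \<in> V \<and> slice_regular V g \<and>
     g (of_real x) \<noteq> 0 \<and> (\<forall>q\<in>circularize V. f q = (q - of_real x) ^ n * g q)"
  have oW: "open W" using W(1) unfolding symmetric_open_def by blast
  have st: "holomorphic_stem W F" using F(1) unfolding induces_def by blast
  have ex: "\<exists>n. ?fac n"
  proof -
    have quot: "\<exists>G. holomorphic_stem W G \<and> (\<forall>w\<in>W. H w = bscalar (w - of_real x) * G w)"
      if "holomorphic_stem W H" "H (of_real x) = 0" for H
      using stem_divide_real[OF W(1) that(1) W(2) that(2)] .
    have R: "(\<lambda>_. 1) holomorphic_on W" "(1 :: complex) \<noteq> 0" "\<And>w. w - of_real x = (w - of_real x) * 1"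
      by auto
    obtain n G where G: "holomorphic_stem W G" "G (of_real x) \<noteq> 0"
      "\<forall>w\<in>W. F w = bscalar ((w - of_real x) ^ n) * G w"
      using stem_factor_out[OF oW W(2) R quot st F(2)] by blast
    obtain g where g: "induces W G g" using holomorphic_stem_imp_induces[OF G(1)] .
    have gval: "g (slice_pt v w) = bval v (G w)" if "w \<in> W" "v \<in> imag_units" for v w
      using g that unfolding induces_def by blast
    have "g (of_real x) \<noteq> 0"
    proof -
      have "g (of_real x) = bval v (G (of_real x))" if "v \<in> imag_units" for v
        using gval[OF W(2) that] by (simp add: slice_pt_real)
      then show ?thesis using bval_all_zero G(2) by metis
    qed
    moreover have "f q = (q - of_real x) ^ n * g q" if "q \<in> circularize W" for q
    proof -
      from \<open>q \<in> circularize W\<close> obtain v w where vw: "v \<in> imag_units" "w \<in> W" "q = slice_pt v w"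
        unfolding circularize_def by blast
      have "f q = bval v (F w)" using F(1) vw unfolding induces_def by blast
      also have "\<dots> = slice_pt v ((w - of_real x) ^ n) * g q"
        using G(3) vw gval by (simp add: bval_scalar_mult)
      also have "slice_pt v ((w - of_real x) ^ n) = (q - of_real x) ^ n"
        unfolding vw(3) by (simp add: slice_pt_power[OF vw(1)] slice_pt_simps)
      finally show ?thesis .
    qed
    moreover have "slice_regular W g" using g slice_regular_iff_induces[OF oW] by blast
    ultimately show ?thesis using W by blast
  qed
  have ord: "zorder (\<lambda>w. bform (F w)) (of_real x) = int (2 * n)" if fac: "?fac n" for n
  proof -
    obtain V g where V: "symmetric_open V" "of_real x \<in> V" and reg: "slice_regular V g"
      and gx: "g (of_real x) \<noteq> 0" and eq: "\<forall>q\<in>circularize V. f q = (q - of_real x) ^ n * g q"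
      using fac by blast
    have oV: "open V" using V(1) unfolding symmetric_open_def by blast
    obtain G where G: "induces V G g" using reg slice_regular_iff_induces[OF oV] by blast
    have stG: "holomorphic_stem V G" using G unfolding induces_def by blast
    have NF: "induces V (\<lambda>w. bscalar ((w - of_real x) ^ n) * G w) f"
    proof (rule induces_scalar_mult[OF G])
      show "(\<lambda>w. (w - of_real x) ^ n) holomorphic_on V" by (intro holomorphic_intros)
      show "(cnj w - of_real x) ^ n = cnj ((w - of_real x) ^ n)" for w by simp
      show "f (slice_pt v w) = slice_pt v ((w - of_real x) ^ n) * g (slice_pt v w)"
        if "w \<in> V" "v \<in> imag_units" for w v
      proof -
        have "slice_pt v w \<in> circularize V" using that unfolding circularize_def by blast
        then show ?thesis using eq that(2) by (simp add: slice_pt_power slice_pt_simps)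
      qed
    qed
    let ?U = "V \<inter> W"
    have oU: "open ?U" and xU: "of_real x \<in> ?U" using oV oW V(2) W(2) by auto
    have FG: "F w = bscalar ((w - of_real x) ^ n) * G w" if "w \<in> ?U" for w
      by (rule induces_unique[OF oU induces_subset[OF F(1)] induces_subset[OF NF] that]) auto
    have "g (of_real x) = bval (Quat 0 1 0 0) (G (of_real x))"
      using G V(2) imag_units_nonempty slice_pt_real unfolding induces_def by metis
    then have "G (of_real x) \<noteq> 0"
      using gx by (auto simp: bval_def breal_def bimag_def quat_eq_iff quat_times_sel)
    then have Gx: "bform (G (of_real x)) \<noteq> 0" using stem_real_bform[OF stG V(2)] by blast
    show ?thesis
    proof (rule zorder_eqI[where g = "\<lambda>w. bform (G w)", OF oU xU _ Gx])
      show "(\<lambda>w. bform (G w)) holomorphic_on ?U"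
        using holomorphic_on_bform[OF stG] by (rule holomorphic_on_subset) blast
      show "bform (F w) = bform (G w) * (w - of_real x) powi int (2 * n)" if "w \<in> ?U" for w
        unfolding FG[OF that] bform_mult bform_bscalar power_int_of_nat
        by (simp add: power_mult mult.commute flip: power_mult)
    qed
  qed
  obtain n where n: "?fac n" using ex by blast
  have "real_zero_mult f x = n"
    unfolding real_zero_mult_def
  proof (rule the_equality)
    show "?fac n" by (rule n)
    show "n' = n" if "?fac n'" for n' using ord[OF that] ord[OF n] by simp
  qed
  then show ?thesis using ord[OF n] by simp
qed


section \<open>Counting all zeros in the domain\<close>

lemma slice_pt_in_closure_circularize:
  assumes "z \<in> closure D" "v \<in> imag_units"
  shows "slice_pt v z \<in> closure (circularize D)"
proof -
  have "continuous_on (closure D) (slice_pt v)"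
    unfolding slice_pt_def by (intro continuous_intros)
  moreover have "slice_pt v ` D \<subseteq> circularize D"
    using assms(2) by (auto simp: circularize_def)
  then have "slice_pt v ` D \<subseteq> closure (circularize D)"
    by (rule order_trans) (rule closure_subset)
  ultimately have "slice_pt v ` closure D \<subseteq> closure (circularize D)"
    by (intro image_closure_subset) auto
  then show ?thesis using assms(1) by blast
qed

lemma slice_pt_in_circularize_iff:
  assumes "symmetric_open D" "v \<in> imag_units"
  shows "slice_pt v z \<in> circularize D \<longleftrightarrow> z \<in> D"
proof
  assume "slice_pt v z \<in> circularize D"
  then obtain w u where w: "w \<in> imag_units" "u \<in> D" "slice_pt v z = slice_pt w u"
    unfolding circularize_def by blast
  then have "z = u \<or> z = cnj u" using slice_pt_eq_iff[OF assms(2) w(1)] by blast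
  then show "z \<in> D" using w(2) assms(1) unfolding symmetric_open_def by blast
qed (use assms(2) in \<open>auto simp: circularize_def\<close>)

text \<open>Carries the hypothesis on the boundary of the quaternionic domain over to the planar one.\<close>

lemma slice_pt_in_frontier_circularize:
  assumes "symmetric_open D" "z \<in> frontier D" "v \<in> imag_units"
  shows "slice_pt v z \<in> frontier (circularize D)"
proof -
  have "z \<in> closure D" "z \<notin> D"
    using assms(1,2) by (auto simp: frontier_def symmetric_open_def interior_open)
  then show ?thesis
    using slice_pt_in_closure_circularize[OF _ assms(3)] slice_pt_in_circularize_iff[OF assms(1,3)]
      interior_subset unfolding frontier_def by blast
qed

lemma closure_subset_of_circularize:
  assumes "symmetric_open W" "closure (circularize D) \<subseteq> circularize W"
  shows "closure D \<subseteq> W"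
proof
  fix z assume "z \<in> closure D"
  then have "slice_pt (Quat 0 1 0 0) z \<in> circularize W"
    using slice_pt_in_closure_circularize[OF _ imag_units_nonempty] assms(2) by blast
  then show "z \<in> W" using slice_pt_in_circularize_iff[OF assms(1) imag_units_nonempty] by simp
qed

text \<open>A non-real sphere of zeros is met by the plane in two conjugate points, one of which is listed in
  \<open>zero_spheres\<close>. Both have order \<open>2 m + n\<close>, so the sphere contributes \<open>4 m + 2 n\<close>, whereas a real
  zero of multiplicity \<open>n\<close> is a single point and contributes \<open>2 n\<close>.\<close>

lemma sum_zorder_bform:
  assumes D: "symmetric_open D" and W: "symmetric_open W" "D \<subseteq> W"
    and F: "induces W F f"
    and fin: "finite {z \<in> D. bform (F z) = 0}"
    and ev: "\<And>z. z \<in> D \<Longrightarrow> \<forall>\<^sub>F w in at z. bform (F w) \<noteq> 0"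
  shows "(\<Sum>z | z \<in> D \<and> bform (F z) = 0. zorder (\<lambda>w. bform (F w)) z) =
    int (2 * isolated_zero_count D f + 4 * spherical_zero_count D f)"
proof -
  let ?H = "\<lambda>z. bform (F z)"
  have cD1: "cnj z \<in> D" if "z \<in> D" for z
    using D that unfolding symmetric_open_def by blast
  have cD: "cnj z \<in> D \<longleftrightarrow> z \<in> D" for z
    using cD1[of z] cD1[of "cnj z"] by auto
  have zero_iff: "?H z = 0 \<longleftrightarrow> (\<exists>q\<in>qsphere z. f q = 0)" if "z \<in> D" for z
  proof -
    have "f (slice_pt v z) = bval v (F z)" if "v \<in> imag_units" for v
      using F W(2) \<open>z \<in> D\<close> that unfolding induces_def by blast
    then show ?thesis unfolding bform_eq_0_iff qsphere_def by fastforce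
  qed
  have Hcnj: "?H (cnj z) = 0 \<longleftrightarrow> ?H z = 0" if "z \<in> D" for z
    using F W(2) that holomorphic_stem_cnj[of W F z] unfolding induces_def by (auto simp: bform_bcnj)
  have real_iff: "(\<exists>q\<in>qsphere (of_real x). f q = 0) \<longleftrightarrow> f (of_real x) = 0" for x
    unfolding qsphere_def using imag_units_nonempty by (auto simp: slice_pt_real)
  define Z where "Z = {z. z \<in> D \<and> ?H z = 0}"
  define R where "R = {x. of_real x \<in> D \<and> f (of_real x) = 0}"
  define U where "U = zero_spheres D f"
  have RZ: "of_real ` R = {z \<in> Z. Im z = 0}"
  proof (intro equalityI subsetI)
    fix z assume "z \<in> {z \<in> Z. Im z = 0}"
    moreover from this have "z = of_real (Re z)" by (simp add: complex_eq_iff)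
    ultimately show "z \<in> of_real ` R"
      unfolding Z_def R_def using zero_iff real_iff[of "Re z"] by (intro image_eqI[of _ _ "Re z"]) auto
  qed (use zero_iff real_iff in \<open>auto simp: Z_def R_def\<close>)
  have UZ: "U = {z \<in> Z. Im z > 0}"
    unfolding U_def zero_spheres_def Z_def using zero_iff by auto
  have LZ: "cnj ` U = {z \<in> Z. Im z < 0}"
  proof (intro equalityI subsetI)
    fix z assume "z \<in> {z \<in> Z. Im z < 0}"
    then show "z \<in> cnj ` U"
      unfolding UZ Z_def using cD Hcnj by (intro image_eqI[of _ _ "cnj z"]) auto
  qed (use cD Hcnj in \<open>auto simp: UZ Z_def\<close>)
  have finZ: "finite Z" using fin unfolding Z_def by simp
  have finU: "finite U" using finZ unfolding UZ by simp
  have finR: "finite (complex_of_real ` R)" using finZ unfolding RZ by simp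
  have finL: "finite (cnj ` U)" using finU by simp
  have Zsplit: "Z = of_real ` R \<union> (U \<union> cnj ` U)"
    unfolding RZ LZ by (subst UZ) auto
  have "U \<inter> cnj ` U = {}" "of_real ` R \<inter> (U \<union> cnj ` U) = {}"
    unfolding RZ LZ by (auto simp: UZ)
  then have "(\<Sum>z\<in>Z. zorder ?H z) =
      (\<Sum>z\<in>of_real ` R. zorder ?H z) + ((\<Sum>z\<in>U. zorder ?H z) + (\<Sum>z\<in>cnj ` U. zorder ?H z))"
    unfolding Zsplit using finU finR finL by (simp add: sum.union_disjoint)
  also have "(\<Sum>z\<in>of_real ` R. zorder ?H z) = (\<Sum>x\<in>R. zorder ?H (of_real x))"
    by (subst sum.reindex) (auto simp: inj_on_def)
  also have "\<dots> = (\<Sum>x\<in>R. int (2 * real_zero_mult f x))"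
    using zorder_bform_real[OF W(1) _ F] W(2) ev by (intro sum.cong) (auto simp: R_def)
  also have "(\<Sum>z\<in>cnj ` U. zorder ?H z) = (\<Sum>z\<in>U. zorder ?H (cnj z))"
    by (subst sum.reindex) (auto simp: inj_on_def)
  also have "\<dots> = (\<Sum>z\<in>U. int (2 * spherical_mult f z + isolated_mult f z))"
  proof (intro sum.cong refl)
    fix z assume "z \<in> U"
    then have "z \<in> D" "Im z \<noteq> 0" unfolding UZ Z_def by auto
    then show "zorder ?H (cnj z) = int (2 * spherical_mult f z + isolated_mult f z)"
      using zorder_bform_nonreal(2)[OF W(1) _ _ F ev] W(2) by blast
  qed
  also have "(\<Sum>z\<in>U. zorder ?H z) = (\<Sum>z\<in>U. int (2 * spherical_mult f z + isolated_mult f z))"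
  proof (intro sum.cong refl)
    fix z assume "z \<in> U"
    then have "z \<in> D" "Im z \<noteq> 0" unfolding UZ Z_def by auto
    then show "zorder ?H z = int (2 * spherical_mult f z + isolated_mult f z)"
      using zorder_bform_nonreal(1)[OF W(1) _ _ F ev] W(2) by blast
  qed
  finally show ?thesis
    unfolding Z_def isolated_zero_count_def spherical_zero_count_def R_def[symmetric] U_def[symmetric]
    by (simp add: sum.distrib flip: sum_distrib_left)
qed

theorem theorem4p2:
  fixes D W :: "complex set" and \<Gamma> :: "(real \<Rightarrow> complex) set"
    and f :: "quat \<Rightarrow> quat" and \<alpha> \<beta> :: "complex \<Rightarrow> quat" and k m :: nat
  assumes "symmetric_open D" and "connected D" and "bounded D"
    and "positively_oriented_boundary D \<Gamma>"
    and "symmetric_open W" and "closure (circularize D) \<subseteq> circularize W"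
    and "slice_stem W f \<alpha> \<beta>"
    and "\<forall>q \<in> frontier (circularize D). f q \<noteq> 0"
    and "k = isolated_zero_count D f" and "m = spherical_zero_count D f"
  shows "1 / (2 * of_real pi * \<i>) *
    (\<Sum>\<gamma>\<in>\<Gamma>. contour_integral \<gamma>
       (\<lambda>z. deriv (Phi \<circ> hol_map \<alpha> \<beta>) z / (Phi \<circ> hol_map \<alpha> \<beta>) z)) = of_nat (2 * k + 4 * m)"
proof (cases "D = {}")
  case True
  have "\<Gamma> = {}"
  proof (rule ccontr)
    assume "\<Gamma> \<noteq> {}"
    then obtain \<gamma> where "\<gamma> \<in> \<Gamma>" by blast
    then have "path_image \<gamma> \<subseteq> frontier D"
      using assms(4) unfolding positively_oriented_boundary_def by blast
    then show False using True by simp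
  qed
  moreover have "k = 0" "m = 0"
    using True assms(9,10)
    by (simp_all add: isolated_zero_count_def spherical_zero_count_def zero_spheres_def)
  ultimately show ?thesis by simp
next
  case False
  define F where "F = (\<lambda>z. bjoin (\<alpha> z) (\<beta> z))"
  have oD: "open D" and oW: "open W" using assms(1,5) unfolding symmetric_open_def by auto
  have F: "induces W F f"
    unfolding F_def using slice_stem_imp_induces[OF oW assms(7)] .
  have H: "Phi \<circ> hol_map \<alpha> \<beta> = (\<lambda>z. bform (F z))"
    unfolding F_def using Phi_hol_map by blast
  have cl: "closure D \<subseteq> W" using closure_subset_of_circularize assms(5,6) .
  have hol: "(\<lambda>z. bform (F z)) holomorphic_on W"
    using F holomorphic_on_bform unfolding induces_def by blast
  have nz: "bform (F z) \<noteq> 0" if z: "z \<in> frontier D" for z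
  proof -
    have "z \<in> W" using z cl by (auto simp: frontier_def)
    then show ?thesis
      using F slice_pt_in_frontier_circularize[OF assms(1) z] assms(8)
      unfolding bform_eq_0_iff induces_def by metis
  qed
  note ap = argument_principle_oriented_boundary[OF oD assms(2,3) False assms(4) oW cl hol nz]
  have "(\<Sum>\<gamma>\<in>\<Gamma>. contour_integral \<gamma> (\<lambda>z. deriv (\<lambda>z. bform (F z)) z / bform (F z))) =
      2 * of_real pi * \<i> * (\<Sum>z | z \<in> D \<and> bform (F z) = 0. of_int (zorder (\<lambda>z. bform (F z)) z))"
    by (rule ap(3))
  also have "(\<Sum>z | z \<in> D \<and> bform (F z) = 0. of_int (zorder (\<lambda>z. bform (F z)) z)) =
      (of_int (\<Sum>z | z \<in> D \<and> bform (F z) = 0. zorder (\<lambda>z. bform (F z)) z) :: complex)"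
    by simp
  also have "(\<Sum>z | z \<in> D \<and> bform (F z) = 0. zorder (\<lambda>z. bform (F z)) z) = int (2 * k + 4 * m)"
    unfolding assms(9,10)
    using cl closure_subset by (intro sum_zorder_bform[OF assms(1,5) _ F] ap(1,2)) auto
  finally show ?thesis unfolding H by simp
qed

end
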